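(* There exists a deterministic polynomial time algorithm which, given a finite ground set $\mathcal{N}$, value oracle access to a non-negative monotone submodular function $f\colon 2^{\mathcal{N}} \to \mathbb{R}_{\geq 0}$, and independence oracle access to a matroid $\mathcal{M} = (\mathcal{N}, \mathcal{I})$, outputs a set $I \in \mathcal{I}$ such that \[ f(I) \geq 0.5008 \cdot \max_{S \in \mathcal{I}} f(S) . \]
   Context: For $u \in \mathcal{N}$ and $S \subseteq \mathcal{N}$ write $f(u \mid S) = f(S \cup \{u\}) - f(S)$. A set function $f$ is monotone if $f(S) \leq f(T)$ for all $S \subseteq T \subseteq \mathcal{N}$, and submodular if $f(u \mid S) \geq f(u \mid T)$ for all $S \subseteq T \subseteq \mathcal{N}$ and $u \in \mathcal{N} \setminus T$. A value oracle for $f$ returns $f(S)$ for any queried $S \subseteq \mathcal{N}$. An independence oracle for $\mathcal{M}$ answers, for any queried $S \subseteq \mathcal{N}$, whether $S \in \mathcal{I}$. Polynomial time means that the number of oracle queries and of other operations is polynomial in $|\mathcal{N}|$. *)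

theory Defs
  imports Complex_Main "HOL-Computational_Algebra.Polynomial"
begin

section \<open>Matroids and submodular functions\<close>

locale matroid =
  fixes N :: "'a set" and Ind :: "'a set set"
  assumes finite_ground: "finite N"
    and indep_subset_ground: "S \<in> Ind \<Longrightarrow> S \<subseteq> N"
    and indep_empty: "{} \<in> Ind"
    and indep_subset: "T \<in> Ind \<Longrightarrow> S \<subseteq> T \<Longrightarrow> S \<in> Ind"
    and indep_augment:
      "S \<in> Ind \<Longrightarrow> T \<in> Ind \<Longrightarrow> card S < card T \<Longrightarrow> \<exists>u \<in> T - S. S \<union> {u} \<in> Ind"

definition marginal :: "('a set \<Rightarrow> real) \<Rightarrow> 'a \<Rightarrow> 'a set \<Rightarrow> real" where
  "marginal f u S = f (S \<union> {u}) - f S"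

definition submodular_on :: "'a set \<Rightarrow> ('a set \<Rightarrow> real) \<Rightarrow> bool" where
  "submodular_on N f \<longleftrightarrow>
     (\<forall>S T u. S \<subseteq> T \<longrightarrow> T \<subseteq> N \<longrightarrow> u \<in> N - T \<longrightarrow> marginal f u S \<ge> marginal f u T)"


section \<open>Deterministic oracle algorithms\<close>

text \<open>
  Algorithms are programs of a while language over arrays of natural numbers and arrays of real
  numbers (the values returned by the value oracle are arbitrary reals). A memory cell is addressed
  by an array name and a list of indices; a scalar variable is an array with the empty index list.

  Every executed atomic command (in particular every oracle query) and test costs one unit. The size of the expressions
  in a fixed program is bounded, so up to a constant factor this is the number of elementary
  operations. Natural numbers can be added, subtracted and compared, but not
  multiplied, so their bit length grows at most linearly in the running time, and unit
  cost is harmless. On reals the operations are those of the algebraic model: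
  field operations and comparison, without rounding. The only real constants are natural
  numbers; arbitrary real constants could encode non-uniform advice.
\<close>

type_synonym vname = string

record state =
  nmem :: "vname \<Rightarrow> nat list \<Rightarrow> nat"
  rmem :: "vname \<Rightarrow> nat list \<Rightarrow> real"

datatype nexp =
    NConst nat
  | NCell vname "nexp list"
  | NAdd nexp nexp
  | NSub nexp nexp

datatype rexp =
    OfNat nexp
  | RCell vname "nexp list"
  | RAdd rexp rexp
  | RSub rexp rexp
  | RMul rexp rexp
  | RDiv rexp rexp

datatype bexp =
    NLess nexp nexp
  | RLess rexp rexp
  | Neg bexp
  | Conj bexp bexp

text \<open>
  \<open>ValueQuery x is a js\<close> stores in the real cell \<open>x[is]\<close> the answer of the value oracle, and
  \<open>IndepQuery x is a js\<close> stores in the natural number cell \<open>x[is]\<close> the answer (1 or 0) of the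
  independence oracle, for the set whose characteristic vector is
  \<open>a[js, 0], \<dots>, a[js, n - 1]\<close>.
\<close>

datatype com =
    Skip
  | NAssign vname "nexp list" nexp
  | RAssign vname "nexp list" rexp
  | ValueQuery vname "nexp list" vname "nexp list"
  | IndepQuery vname "nexp list" vname "nexp list"
  | Seq com com
  | IfElse bexp com com
  | While bexp com

primrec nval :: "nexp \<Rightarrow> state \<Rightarrow> nat" where
  "nval (NConst m) s = m"
| "nval (NCell x is) s = nmem s x (map (\<lambda>e. nval e s) is)"
| "nval (NAdd a b) s = nval a s + nval b s"
| "nval (NSub a b) s = nval a s - nval b s"

primrec rval :: "rexp \<Rightarrow> state \<Rightarrow> real" where
  "rval (OfNat a) s = real (nval a s)"
| "rval (RCell x is) s = rmem s x (map (\<lambda>e. nval e s) is)"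
| "rval (RAdd a b) s = rval a s + rval b s"
| "rval (RSub a b) s = rval a s - rval b s"
| "rval (RMul a b) s = rval a s * rval b s"
| "rval (RDiv a b) s = rval a s / rval b s"

primrec bval :: "bexp \<Rightarrow> state \<Rightarrow> bool" where
  "bval (NLess a b) s \<longleftrightarrow> nval a s < nval b s"
| "bval (RLess a b) s \<longleftrightarrow> rval a s < rval b s"
| "bval (Neg b) s \<longleftrightarrow> \<not> bval b s"
| "bval (Conj b c) s \<longleftrightarrow> bval b s \<and> bval c s"

abbreviation indices :: "nexp list \<Rightarrow> state \<Rightarrow> nat list" where
  "indices is s \<equiv> map (\<lambda>e. nval e s) is"

definition write_nat :: "vname \<Rightarrow> nat list \<Rightarrow> nat \<Rightarrow> state \<Rightarrow> state" where
  "write_nat x is v s = s\<lparr>nmem := (nmem s)(x := (nmem s x)(is := v))\<rparr>"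

definition write_real :: "vname \<Rightarrow> nat list \<Rightarrow> real \<Rightarrow> state \<Rightarrow> state" where
  "write_real x is v s = s\<lparr>rmem := (rmem s)(x := (rmem s x)(is := v))\<rparr>"

definition stored_set :: "nat \<Rightarrow> state \<Rightarrow> vname \<Rightarrow> nat list \<Rightarrow> nat set" where
  "stored_set n s a js = {i. i < n \<and> nmem s a (js @ [i]) \<noteq> 0}"

text \<open>
  \<open>exec n vo io c s k t\<close>: on a ground set of \<open>n\<close> elements, numbered \<open>0, \<dots>, n - 1\<close>, with value
  oracle \<open>vo\<close> and independence oracle \<open>io\<close>, the program \<open>c\<close> started in state \<open>s\<close> halts in state
  \<open>t\<close> at cost \<open>k\<close>.
\<close>

inductive exec ::
  "nat \<Rightarrow> (nat set \<Rightarrow> real) \<Rightarrow> (nat set \<Rightarrow> bool) \<Rightarrow> com \<Rightarrow> state \<Rightarrow> nat \<Rightarrow> state \<Rightarrow> bool"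
  for n :: nat and vo :: "nat set \<Rightarrow> real" and io :: "nat set \<Rightarrow> bool"
where
  Skip: "exec n vo io Skip s 1 s"
| NAssign: "exec n vo io (NAssign x is e) s 1 (write_nat x (indices is s) (nval e s) s)"
| RAssign: "exec n vo io (RAssign x is e) s 1 (write_real x (indices is s) (rval e s) s)"
| ValueQuery: "exec n vo io (ValueQuery x is a js) s 1
    (write_real x (indices is s) (vo (stored_set n s a (indices js s))) s)"
| IndepQuery: "exec n vo io (IndepQuery x is a js) s 1
    (write_nat x (indices is s) (if io (stored_set n s a (indices js s)) then 1 else 0) s)"
| Seq: "exec n vo io c s k s' \<Longrightarrow> exec n vo io d s' l t \<Longrightarrow> exec n vo io (Seq c d) s (k + l) t"
| IfTrue: "bval b s \<Longrightarrow> exec n vo io c s k t \<Longrightarrow> exec n vo io (IfElse b c d) s (1 + k) t"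
| IfFalse: "\<not> bval b s \<Longrightarrow> exec n vo io d s k t \<Longrightarrow> exec n vo io (IfElse b c d) s (1 + k) t"
| WhileFalse: "\<not> bval b s \<Longrightarrow> exec n vo io (While b c) s 1 s"
| WhileTrue: "bval b s \<Longrightarrow> exec n vo io c s k s' \<Longrightarrow> exec n vo io (While b c) s' l t \<Longrightarrow>
    exec n vo io (While b c) s (1 + k + l) t"

inductive_cases exec_SkipE: "exec n vo io Skip s k t"
inductive_cases exec_NAssignE: "exec n vo io (NAssign x is e) s k t"
inductive_cases exec_RAssignE: "exec n vo io (RAssign x is e) s k t"
inductive_cases exec_ValueQueryE: "exec n vo io (ValueQuery x is a js) s k t"
inductive_cases exec_IndepQueryE: "exec n vo io (IndepQuery x is a js) s k t"
inductive_cases exec_SeqE: "exec n vo io (Seq c d) s k t"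
inductive_cases exec_IfElseE: "exec n vo io (IfElse b c d) s k t"
inductive_cases exec_WhileE: "exec n vo io (While b c) s k t"

lemma exec_deterministic:
  assumes "exec n vo io c s k t" and "exec n vo io c s k' t'"
  shows "k' = k \<and> t' = t"
  using assms
proof (induction arbitrary: k' t' rule: exec.induct)
  case (Seq c s k s' d l t)
  from Seq.prems show ?case
  proof (rule exec_SeqE)
    fix k1 s1 l1
    assume run: "k' = k1 + l1" "exec n vo io c s k1 s1" "exec n vo io d s1 l1 t'"
    from Seq.IH(1)[OF run(2)] have eq: "k1 = k" "s1 = s'" by simp_all
    from Seq.IH(2)[OF run(3)[unfolded eq]] run(1) eq show ?thesis by simp
  qed
next
  case (IfTrue b s c k t d)
  from IfTrue.prems have "\<exists>k1. k' = Suc k1 \<and> exec n vo io c s k1 t'"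
    by (rule exec_IfElseE) (use IfTrue.hyps in simp_all)
  then obtain k1 where run: "k' = Suc k1" "exec n vo io c s k1 t'" by blast
  from IfTrue.IH[OF run(2)] run(1) show ?case by simp
next
  case (IfFalse b s d k t c)
  from IfFalse.prems have "\<exists>k1. k' = Suc k1 \<and> exec n vo io d s k1 t'"
    by (rule exec_IfElseE) (use IfFalse.hyps in simp_all)
  then obtain k1 where run: "k' = Suc k1" "exec n vo io d s k1 t'" by blast
  from IfFalse.IH[OF run(2)] run(1) show ?case by simp
next
  case (WhileFalse b s c)
  from WhileFalse.prems show ?case
    by (rule exec_WhileE) (use WhileFalse.hyps in simp_all)
next
  case (WhileTrue b s c k s' l t)
  from WhileTrue.prems show ?case
  proof (rule exec_WhileE)
    assume "\<not> bval b s"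
    with WhileTrue.hyps(1) show ?thesis by simp
  next
    fix k1 s1 l1
    assume run: "k' = Suc (k1 + l1)" "exec n vo io c s k1 s1" "exec n vo io (While b c) s1 l1 t'"
    from WhileTrue.IH(1)[OF run(2)] have eq: "k1 = k" "s1 = s'" by simp_all
    from WhileTrue.IH(2)[OF run(3)[unfolded eq]] run(1) eq show ?thesis by simp
  qed
qed (erule exec_SkipE exec_NAssignE exec_RAssignE exec_ValueQueryE exec_IndepQueryE, simp)+

definition initial_state :: "nat \<Rightarrow> state" where
  "initial_state n =
     write_nat ''n'' [] n \<lparr>nmem = (\<lambda>x is. 0), rmem = (\<lambda>x is. 0)\<rparr>"

text \<open>
  \<open>outputs c xs f Ind I k\<close>: on the ground set enumerated by \<open>xs\<close>, the program \<open>c\<close> halts after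
  \<open>k\<close> operations with output \<open>I\<close>. The program sees the element \<open>xs ! i\<close> only as the number \<open>i\<close>,
  and \<open>f\<close> and \<open>Ind\<close> only through the two oracles. The output is the set whose characteristic
  vector is left in the array \<open>out\<close>.
\<close>

definition outputs ::
  "com \<Rightarrow> 'a list \<Rightarrow> ('a set \<Rightarrow> real) \<Rightarrow> 'a set set \<Rightarrow> 'a set \<Rightarrow> nat \<Rightarrow> bool" where
  "outputs c xs f Ind I k \<longleftrightarrow>
     (\<exists>t. exec (length xs) (\<lambda>X. f ((!) xs ` X)) (\<lambda>X. (!) xs ` X \<in> Ind)
            c (initial_state (length xs)) k t \<and>
          I = (!) xs ` stored_set (length xs) t ''out'' [])"

lemma outputs_deterministic:
  "outputs c xs f Ind I k \<Longrightarrow> outputs c xs f Ind I' k' \<Longrightarrow> I' = I \<and> k' = k"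
  unfolding outputs_def by (elim exE conjE) (drule (1) exec_deterministic, simp)

end

theory Submission
  imports Defs
begin

text \<open>
  The algorithm is a non-oblivious local search. It maintains disjoint sets \<open>A\<close> and \<open>B\<close> whose union
  is a base, and exchanges an element of \<open>A \<union> B\<close> for an element put into \<open>A\<close> or into \<open>B\<close> as long as
  this increases \<open>2 f A + 2 f B + 3 f (A \<union> B)\<close> by more than \<open>M / (3 n)\<close>, where \<open>M\<close> is the largest
  value of an independent singleton. As this potential is at most \<open>7 n M\<close>, there are at most
  \<open>21 n\<^sup>2\<close> exchanges. Adding up the conditions for local optimality along a bijection between
  \<open>A \<union> B\<close> and an optimal base \<open>T\<close> gives \<open>10 f T \<le> 18 f (A \<union> B) + 2 M / 3\<close>, hence a ratio of
  \<open>14 / 27 > 0.5008\<close>; without the slack it would be \<open>5 / 9\<close>.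
\<close>

section \<open>Exchange between bases\<close>

context matroid
begin

text \<open>Maximum cardinality stands in for maximality under inclusion. By augmentation both give
  the same sets, and the exchange arguments compare cardinalities.\<close>

definition base :: "'a set \<Rightarrow> bool" where
  "base S \<longleftrightarrow> S \<in> Ind \<and> (\<forall>T\<in>Ind. card T \<le> card S)"

lemma indep_finite: "S \<in> Ind \<Longrightarrow> finite S"
  using indep_subset_ground finite_ground finite_subset by blast

lemma finite_Ind: "finite Ind"
  by (rule finite_subset[of _ "Pow N"]) (use indep_subset_ground finite_ground in auto)

lemma indep_extend:
  assumes "S \<in> Ind" "T \<in> Ind" "card S \<le> card T"
  obtains S' where "S' \<in> Ind" "S \<subseteq> S'" "S' \<subseteq> S \<union> T" "card S' = card T"
proof -
  have "\<exists>S'\<in>Ind. S \<subseteq> S' \<and> S' \<subseteq> S \<union> T \<and> card S' = card T"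
    using assms
  proof (induction "card T - card S" arbitrary: S)
    case 0
    then show ?case by auto
  next
    case (Suc d)
    then have "card S < card T" by linarith
    then obtain u where u: "u \<in> T - S" "S \<union> {u} \<in> Ind"
      using indep_augment Suc.prems by blast
    have card: "card (S \<union> {u}) = Suc (card S)"
      using u(1) indep_finite[OF Suc.prems(1)] by simp
    obtain S' where "S' \<in> Ind" "S \<union> {u} \<subseteq> S'" "S' \<subseteq> S \<union> {u} \<union> T" "card S' = card T"
      using Suc.hyps(1)[of "S \<union> {u}"] Suc.hyps(2) u Suc.prems \<open>card S < card T\<close> card
      by force
    then show ?case using u(1) by blast
  qed
  then show ?thesis using that by blast
qed

lemma base_extend:
  assumes "S \<in> Ind"
  obtains T where "base T" "S \<subseteq> T"
proof -
  have "Max (card ` Ind) \<in> card ` Ind"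
    using finite_Ind indep_empty by (intro Max_in) auto
  then obtain R where R: "R \<in> Ind" "card R = Max (card ` Ind)" by auto
  have max: "card T \<le> card R" if "T \<in> Ind" for T
    using that finite_Ind R(2) by simp
  obtain T where "T \<in> Ind" "S \<subseteq> T" "card T = card R"
    by (rule indep_extend[OF assms R(1) max[OF assms]])
  then show ?thesis using that max unfolding base_def by metis
qed

text \<open>The set \<open>D\<close> in the proof is the fundamental circuit of \<open>e\<close>
  with respect to \<open>T\<close>, without \<open>e\<close>. Were there no exchange,
  \<open>D\<close> would lie in the span of \<open>S - {e}\<close>; the circuit then puts
  \<open>e\<close> into that span too, against the independence of \<open>S\<close>.\<close>

lemma base_symmetric_exchange:
  assumes S: "base S" and T: "base T" and e: "e \<in> S - T"
  shows "\<exists>w\<in>T - S. insert w (S - {e}) \<in> Ind \<and> insert e (T - {w}) \<in> Ind"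
proof (rule ccontr)
  assume contra: "\<not> ?thesis"
  then have none: "insert w (S - {e}) \<notin> Ind"
    if "w \<in> T - S" "insert e (T - {w}) \<in> Ind" for w
    using contra that by blast
  have Ind: "S \<in> Ind" "T \<in> Ind" using S T by (auto simp: base_def)
  have fin: "finite S" "finite T" using Ind indep_finite by auto
  define D where "D = {w \<in> T. insert e (T - {w}) \<in> Ind}"
  have D: "D \<in> Ind" by (rule indep_subset[OF Ind(2)]) (auto simp: D_def)
  have Se: "S - {e} \<in> Ind" by (rule indep_subset[OF Ind(1)]) auto
  have card_Se: "card (S - {e}) < card S" using e fin by (meson DiffD1 card_Diff1_less)
  \<comment> \<open>If independent, \<open>insert e D\<close> extends inside
    \<open>insert e T\<close> to the size of \<open>T\<close>, thus to
    \<open>insert e (T - {w})\<close> with \<open>w\<close> outside \<open>D\<close>; but this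
    independence puts \<open>w\<close> into \<open>D\<close>.\<close>
  have De: "insert e D \<notin> Ind"
  proof
    assume "insert e D \<in> Ind"
    moreover have "card (insert e D) \<le> card T"
      using T \<open>insert e D \<in> Ind\<close> by (auto simp: base_def)
    ultimately obtain X where X: "X \<in> Ind" "insert e D \<subseteq> X" "X \<subseteq> insert e D \<union> T"
      "card X = card T"
      using indep_extend[of "insert e D" T] Ind(2) by blast
    have sub: "X \<subseteq> insert e T" using X(3) by (auto simp: D_def)
    have "X \<noteq> insert e T" using X(4) e fin by auto
    then obtain w where w: "w \<in> insert e T" "w \<notin> X" using sub by blast
    have "w \<in> T" "w \<notin> D" using w X(2) by auto
    have "card (insert e (T - {w})) = card T"
      using e fin \<open>w \<in> T\<close> card_Suc_Diff1[OF fin(2) \<open>w \<in> T\<close>] by auto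
    then have "X = insert e (T - {w})"
      using sub w X(4) fin by (intro card_subset_eq) auto
    then show False using X(1) \<open>w \<in> T\<close> \<open>w \<notin> D\<close> by (auto simp: D_def)
  qed
  \<comment> \<open>The span statement as a rank statement: an element of \<open>Y\<close>
    augmenting \<open>S - {e}\<close> would lie in \<open>D - S\<close> and be a valid exchange
    partner.\<close>
  have no_aug: False if Y: "Y \<in> Ind" "Y \<subseteq> D \<union> (S - {e})" "card (S - {e}) < card Y" for Y
  proof -
    obtain y where y: "y \<in> Y - (S - {e})" "(S - {e}) \<union> {y} \<in> Ind"
      using indep_augment[OF Se Y(1,3)] by blast
    then have "y \<in> T - S" using Y(2) y(1) e by (auto simp: D_def)
    then show False using none[of y] y Y(2) by (auto simp: D_def)
  qed
  then have "card D \<le> card (S - {e})" using D by (meson Un_upper1 leI)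
  then obtain D' where D': "D' \<in> Ind" "D \<subseteq> D'" "D' \<subseteq> D \<union> (S - {e})"
    "card D' = card (S - {e})"
    using indep_extend[OF D Se] by blast
  \<comment> \<open>\<open>S\<close> is larger than \<open>D'\<close> by one. The new element is
    either \<open>e\<close>, which contradicts \<open>De\<close>, or another one, which contradicts
    \<open>no_aug\<close>.\<close>
  obtain x where x: "x \<in> S - D'" "D' \<union> {x} \<in> Ind"
    using indep_augment[OF D'(1) Ind(1)] D'(4) card_Se by auto
  show False
  proof (cases "x = e")
    case True
    then show False using De indep_subset[OF x(2), of "insert e D"] D'(2) by auto
  next
    case False
    have "card (D' \<union> {x}) = Suc (card D')" using x(1) indep_finite[OF D'(1)] by simp
    then show False using no_aug[OF x(2)] D' x(1) False by auto
  qed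
qed

text \<open>Induction on \<open>card (S - T)\<close>: a symmetric exchange keeps \<open>T\<close> a
  base and brings it one element closer to \<open>S\<close>. In the last property a common element
  is exchanged for itself, so every image is either outside \<open>S\<close> or equal to its
  argument.\<close>

lemma base_exchange_bijection:
  assumes "base S" "base T"
  obtains h where "bij_betw h S T"
    "\<And>e. e \<in> S \<Longrightarrow> insert (h e) (S - {e}) \<in> Ind"
    "\<And>e. e \<in> S \<Longrightarrow> h e \<in> S \<Longrightarrow> h e = e"
proof -
  have "\<exists>h. bij_betw h S T \<and> (\<forall>e\<in>S. insert (h e) (S - {e}) \<in> Ind) \<and> (\<forall>e\<in>S \<inter> T. h e = e)"
    using assms
  proof (induction "card (S - T)" arbitrary: T)
    case 0
    then have Ind: "S \<in> Ind" "T \<in> Ind" and card: "card S = card T"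
      by (auto simp: base_def intro: antisym)
    then have "finite S" "finite T" using indep_finite by auto
    then have "S \<subseteq> T" using 0 by auto
    then have "S = T" using card \<open>finite T\<close> by (simp add: card_subset_eq)
    then show ?case using Ind by (intro exI[of _ id]) (auto simp: insert_absorb bij_betw_def)
  next
    case (Suc d)
    have Ind: "S \<in> Ind" "T \<in> Ind" using Suc.prems by (auto simp: base_def)
    then have fin: "finite S" "finite T" using indep_finite by auto
    from Suc.hyps(2) obtain e where e: "e \<in> S - T" by (metis card.empty equals0I nat.distinct(1))
    obtain w where w: "w \<in> T - S" "insert w (S - {e}) \<in> Ind" "insert e (T - {w}) \<in> Ind"
      using base_symmetric_exchange[OF Suc.prems e] by blast
    let ?T = "insert e (T - {w})"
    have "card ?T = card T"
      using e w(1) fin card_Suc_Diff1[of T w] by auto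
    then have "base ?T" using w(3) Suc.prems(2) by (simp add: base_def)
    moreover have "S - ?T = S - T - {e}" using w(1) by auto
    then have "d = card (S - ?T)" using Suc.hyps(2) e fin by simp
    ultimately obtain h where h: "bij_betw h S ?T" "\<forall>e\<in>S. insert (h e) (S - {e}) \<in> Ind"
      "\<forall>e\<in>S \<inter> ?T. h e = e"
      using Suc.hyps(1)[of ?T] Suc.prems(1) by blast
    \<comment> \<open>\<open>e\<close> now lies in both bases, so the induction hypothesis fixes it,
      and it can be redirected to \<open>w\<close> without touching other values.\<close>
    have he: "h e = e" using h(3) e by auto
    have "bij_betw h (S - {e}) (T - {w})"
      using bij_betw_DiffI[OF h(1), of "{e}" "{e}"] he e w(1)
      by (simp add: bij_betw_def insert_Diff_if)
    then have "bij_betw (h(e := w)) (S - {e}) (T - {w})"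
      by (rule bij_betw_cong[THEN iffD1, rotated]) auto
    then have "bij_betw (h(e := w)) (insert e (S - {e})) (insert w (T - {w}))"
      using notIn_Un_bij_betw[of e "S - {e}" "h(e := w)" "T - {w}"] by auto
    moreover have "insert e (S - {e}) = S" "insert w (T - {w}) = T" using e w(1) by auto
    ultimately have "bij_betw (h(e := w)) S T" by simp
    then show ?case using h w e by (intro exI[of _ "h(e := w)"]) auto
  qed
  then obtain h where h: "bij_betw h S T" "\<forall>e\<in>S. insert (h e) (S - {e}) \<in> Ind"
    "\<forall>e\<in>S \<inter> T. h e = e" by blast
  \<comment> \<open>\<open>h e\<close> lies in both \<open>S\<close> and \<open>T\<close>, hence is
    itself fixed; injectivity gives the claim.\<close>
  have "h e = e" if "e \<in> S" "h e \<in> S" for e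
  proof -
    have "h e \<in> T" using h(1) that(1) bij_betwE by blast
    then have "h (h e) = h e" using h(3) that by blast
    then show ?thesis using h(1) that by (auto simp: bij_betw_def dest: inj_onD)
  qed
  then show ?thesis using that h by blast
qed

end

section \<open>Transport of matroids and submodular functions along a bijection\<close>

lemma matroid_vimage:
  assumes "matroid N Ind" "bij_betw g M N"
  shows "matroid M {X. X \<subseteq> M \<and> g ` X \<in> Ind}"
proof -
  interpret matroid N Ind by fact
  have inj: "inj_on g M" and img: "g ` M = N" using assms(2) by (auto simp: bij_betw_def)
  have card: "card (g ` X) = card X" if "X \<subseteq> M" for X
    using inj that by (meson card_image inj_on_subset)
  show ?thesis
  proof
    show "finite M" using assms(2) finite_ground bij_betw_finite by blast
    show "{} \<in> {X. X \<subseteq> M \<and> g ` X \<in> Ind}" using indep_empty by simp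
    show "S \<in> {X. X \<subseteq> M \<and> g ` X \<in> Ind}"
      if "T \<in> {X. X \<subseteq> M \<and> g ` X \<in> Ind}" "S \<subseteq> T" for S T
      using that indep_subset[of "g ` T" "g ` S"] by auto
  next
    fix S T assume ST: "S \<in> {X. X \<subseteq> M \<and> g ` X \<in> Ind}" "T \<in> {X. X \<subseteq> M \<and> g ` X \<in> Ind}"
      "card S < card T"
    then obtain u where "u \<in> g ` T - g ` S" "g ` S \<union> {u} \<in> Ind"
      using indep_augment[of "g ` S" "g ` T"] card by auto
    then obtain w where "w \<in> T - S" "g ` (S \<union> {w}) \<in> Ind" by auto
    then show "\<exists>u\<in>T - S. S \<union> {u} \<in> {X. X \<subseteq> M \<and> g ` X \<in> Ind}"
      using ST by (intro bexI[of _ w]) auto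
  qed auto
qed

lemma submodular_on_vimage:
  assumes "submodular_on N f" "bij_betw g M N"
  shows "submodular_on M (\<lambda>X. f (g ` X))"
  unfolding submodular_on_def marginal_def
proof (intro allI impI)
  fix S T u assume *: "S \<subseteq> T" "T \<subseteq> M" "u \<in> M - T"
  have inj: "inj_on g M" and img: "g ` M = N" using assms(2) by (auto simp: bij_betw_def)
  have "g u \<in> N - g ` T" using * inj img by (auto dest: inj_onD)
  moreover have "g ` S \<subseteq> g ` T" "g ` T \<subseteq> N" using * img by auto
  ultimately show "f (g ` (T \<union> {u})) - f (g ` T) \<le> f (g ` (S \<union> {u})) - f (g ` S)"
    using assms(1) unfolding submodular_on_def marginal_def by (simp add: insert_is_Un[symmetric])
qed

section \<open>Local optima\<close>

locale submodular_matroid = matroid N Ind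
  for N :: "'a set" and Ind +
  fixes f :: "'a set \<Rightarrow> real"
  assumes nonneg: "S \<subseteq> N \<Longrightarrow> 0 \<le> f S"
    and mono: "mono_on (Pow N) f"
    and submodular: "submodular_on N f"
begin

lemma f_mono: "S \<subseteq> T \<Longrightarrow> T \<subseteq> N \<Longrightarrow> f S \<le> f T"
  using mono by (auto simp: mono_on_def)

text \<open>For \<open>u\<close> in \<open>T\<close> the left side is 0 and monotonicity replaces
  submodularity, so later sums need no case distinction on membership.\<close>

lemma diminishing:
  assumes "S \<subseteq> T" "T \<subseteq> N" "u \<in> N"
  shows "f (insert u T) - f T \<le> f (insert u S) - f S"
proof (cases "u \<in> T")
  case True
  then show ?thesis using f_mono[of S "insert u S"] assms by (auto simp: insert_absorb)
next
  case False
  then show ?thesis using submodular assms by (auto simp: submodular_on_def marginal_def)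
qed

lemma gain_sum:
  assumes "S \<subseteq> N" "D \<subseteq> N"
  shows "f (S \<union> D) - f S \<le> (\<Sum>u\<in>D. f (insert u S) - f S)"
proof -
  have "finite D" using assms finite_ground by (meson finite_subset)
  then show ?thesis using assms(2)
  proof (induction D)
    case (insert u D)
    have "f (insert u (S \<union> D)) - f (S \<union> D) \<le> f (insert u S) - f S"
      using insert assms(1) by (intro diminishing) auto
    then show ?case using insert by simp
  qed simp
qed

text \<open>Deleting \<open>u\<close> from all of \<open>S\<close> costs no more than deleting it
  after other elements have gone; deleting \<open>D\<close> one element at a time
  telescopes.\<close>

lemma loss_sum:
  assumes "S \<subseteq> N" "D \<subseteq> S"
  shows "(\<Sum>u\<in>D. f S - f (S - {u})) \<le> f S - f (S - D)"
proof -
  have "finite D" using assms finite_ground by (meson finite_subset)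
  then show ?thesis using assms(2)
  proof (induction D)
    case (insert u D)
    have "f (insert u (S - {u})) - f (S - {u}) \<le>
        f (insert u (S - insert u D)) - f (S - insert u D)"
      using insert assms(1) by (intro diminishing) auto
    moreover have "insert u (S - {u}) = S" "insert u (S - insert u D) = S - D"
      using insert by auto
    ultimately show ?case using insert by simp
  qed simp
qed

lemma swap_gain:
  assumes "X \<subseteq> N" "e \<in> N" "v \<in> N"
  shows "f (insert v (X - {e})) - f X \<ge> (f (insert v X) - f X) - (f X - f (X - {e}))"
  using diminishing[of "X - {e}" X v] assms by auto

definition potential :: "'a set \<Rightarrow> 'a set \<Rightarrow> real" where
  "potential A B = 2 * f A + 2 * f B + 3 * f (A \<union> B)"

lemma potential_le:
  assumes "A \<union> B \<subseteq> N" shows "potential A B \<le> 7 * f (A \<union> B)"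
  using f_mono[of A "A \<union> B"] f_mono[of B "A \<union> B"] assms by (simp add: potential_def)

text \<open>Each singleton contributes at most \<open>M - f {}\<close>. As \<open>S\<close> has at
  least one element, one of the subtracted copies of \<open>f {}\<close> pays for the
  \<open>f {}\<close> on the left; for the empty set the bound can fail.\<close>

lemma le_card_times_singleton:
  assumes "S \<in> Ind" "S \<noteq> {}" and M: "\<And>u. {u} \<in> Ind \<Longrightarrow> f {u} \<le> M"
  shows "f S \<le> real (card N) * M"
proof -
  have S: "S \<subseteq> N" "finite S" using assms(1) by (rule indep_subset_ground, rule indep_finite)
  have single: "{u} \<in> Ind" if "u \<in> S" for u by (rule indep_subset[OF assms(1)]) (use that in auto)
  obtain u where "u \<in> S" using assms(2) by auto
  then have "0 \<le> M" using M[OF single] nonneg[of "{u}"] S by force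
  have card: "1 \<le> real (card S)" "card S \<le> card N"
    using S assms(2) finite_ground
    by (auto simp: Suc_leI card_gt_0_iff card_mono)
  have "f S - f {} \<le> (\<Sum>u\<in>S. f {u} - f {})" using gain_sum[of "{}" S] S by simp
  also have "\<dots> \<le> (\<Sum>u\<in>S. M - f {})" using M single by (intro sum_mono) auto
  also have "\<dots> = real (card S) * M - real (card S) * f {}" by (simp add: algebra_simps)
  also have "\<dots> \<le> real (card N) * M - 1 * f {}"
    using card \<open>0 \<le> M\<close> nonneg[of "{}"] by (intro diff_mono mult_right_mono) auto
  finally show ?thesis by simp
qed

text \<open>
  The weights 2, 2, 3 of the potential are the ones for which \<open>f A + f B\<close> cancels when the
  inequalities of all exchanges between \<open>A \<union> B\<close> and two copies of \<open>T\<close>, one inserted into \<open>A\<close> and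
  one into \<open>B\<close>, are added.
\<close>

lemma local_optimum_bound:
  assumes disj: "A \<inter> B = {}" and base: "base (A \<union> B)" "base T"
    and opt: "\<And>e v. e \<in> A \<union> B \<Longrightarrow> v \<notin> A \<union> B - {e} \<Longrightarrow> insert v (A \<union> B - {e}) \<in> Ind \<Longrightarrow>
      potential (insert v (A - {e})) (B - {e}) \<le> potential A B + \<theta> \<and>
      potential (A - {e}) (insert v (B - {e})) \<le> potential A B + \<theta>"
  shows "10 * f T \<le> 18 * f (A \<union> B) + 2 * real (card T) * \<theta>"
proof -
  let ?S = "A \<union> B"
  have S: "?S \<subseteq> N" "finite ?S" and T: "T \<subseteq> N" "finite T"
    using base indep_subset_ground indep_finite unfolding base_def by blast+
  obtain h where h: "bij_betw h ?S T" "\<And>e. e \<in> ?S \<Longrightarrow> insert (h e) (?S - {e}) \<in> Ind"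
    "\<And>e. e \<in> ?S \<Longrightarrow> h e \<in> ?S \<Longrightarrow> h e = e"
    using base_exchange_bijection[OF base] by blast
  define gain where "gain X v = f (insert v X) - f X" for X v
  define loss where "loss X e = f X - f (X - {e})" for X e
  \<comment> \<open>The sum of the two optimality conditions for exchanging \<open>e\<close> for
    \<open>h e\<close>, one inserting into \<open>A\<close> and one into \<open>B\<close>. Each set
    takes part in two losses, \<open>A\<close> and \<open>B\<close> in one gain each, and the union
    in two.\<close>
  have single: "2 * gain A (h e) + 2 * gain B (h e) + 6 * gain ?S (h e)
      \<le> 4 * loss A e + 4 * loss B e + 6 * loss ?S e + 2 * \<theta>" if e: "e \<in> ?S" for e
  proof -
    let ?v = "h e"
    have v: "?v \<in> N" "e \<in> N" using h(1) e T S bij_betwE by blast+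
    have "?v \<notin> ?S - {e}" using h(3)[OF e] by auto
    note o = opt[OF e this h(2)[OF e]]
    have U: "insert ?v (A - {e}) \<union> (B - {e}) = insert ?v (?S - {e})"
      "(A - {e}) \<union> insert ?v (B - {e}) = insert ?v (?S - {e})" by auto
    show ?thesis
      using o swap_gain[of A e ?v] swap_gain[of B e ?v] swap_gain[of ?S e ?v] v S
      unfolding potential_def U gain_def loss_def by simp
  qed
  have gains: "f T - f X \<le> (\<Sum>e\<in>?S. gain X (h e))" if "X \<subseteq> N" for X
  proof -
    have "f T - f X \<le> f (X \<union> T) - f X" using f_mono[of T "X \<union> T"] that T by simp
    also have "\<dots> \<le> (\<Sum>v\<in>T. gain X v)" unfolding gain_def using gain_sum that T by blast
    also have "\<dots> = (\<Sum>e\<in>?S. gain X (h e))" using h(1) sum.reindex_bij_betw by metis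
    finally show ?thesis .
  qed
  \<comment> \<open>Elements outside \<open>X\<close> have loss 0, and deleting all of
    \<open>X\<close> loses at most \<open>f X\<close>.\<close>
  have losses: "(\<Sum>e\<in>?S. loss X e) \<le> f X" if "X \<subseteq> ?S" for X
  proof -
    have "(\<Sum>e\<in>?S. loss X e) = (\<Sum>e\<in>X. loss X e)"
      using that S by (intro sum.mono_neutral_right) (auto simp: loss_def)
    also have "\<dots> \<le> f X - f (X - X)"
      unfolding loss_def using loss_sum[of X X] that S by blast
    finally show ?thesis using nonneg[of "{}"] by simp
  qed
  \<comment> \<open>For the union the losses are split: deleting \<open>A\<close> leaves
    \<open>B\<close> and conversely. The resulting \<open>- f A - f B\<close> is what makes these
    values cancel at the end.\<close>
  have "(\<Sum>e\<in>?S. loss ?S e) = (\<Sum>e\<in>A. loss ?S e) + (\<Sum>e\<in>B. loss ?S e)"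
    using S disj by (intro sum.union_disjoint) auto
  also have "\<dots> \<le> (f ?S - f (?S - A)) + (f ?S - f (?S - B))"
    unfolding loss_def using loss_sum[OF S(1), of A] loss_sum[OF S(1), of B] by auto
  also have "?S - A = B" using disj by auto
  also have "?S - B = A" using disj by auto
  finally have "(\<Sum>e\<in>?S. loss ?S e) \<le> 2 * f ?S - f A - f B" by simp
  moreover have "2 * (\<Sum>e\<in>?S. gain A (h e)) + 2 * (\<Sum>e\<in>?S. gain B (h e)) + 6 * (\<Sum>e\<in>?S. gain ?S (h e))
      \<le> 4 * (\<Sum>e\<in>?S. loss A e) + 4 * (\<Sum>e\<in>?S. loss B e) + 6 * (\<Sum>e\<in>?S. loss ?S e) + 2 * real (card ?S) * \<theta>"
    using sum_mono[of ?S, OF single] by (simp add: sum.distrib sum_distrib_left mult.assoc mult.left_commute)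
  moreover have "card ?S = card T" using h(1) bij_betw_same_card by blast
  ultimately show ?thesis
    using gains[of A] gains[of B] gains[OF S(1)] losses[of A] losses[of B] S by simp
qed

end

section \<open>Reasoning about programs\<close>

text \<open>Total correctness with a cost bound. Execution is deterministic, so one halting run
  describes all of them.\<close>

definition runs ::
  "nat \<Rightarrow> (nat set \<Rightarrow> real) \<Rightarrow> (nat set \<Rightarrow> bool) \<Rightarrow> com \<Rightarrow> state \<Rightarrow> nat \<Rightarrow> (state \<Rightarrow> bool) \<Rightarrow> bool"
where
  "runs n vo io c s K Q \<longleftrightarrow> (\<exists>k t. exec n vo io c s k t \<and> k \<le> K \<and> Q t)"

lemma runs_mono:
  assumes "runs n vo io c s K Q" "K \<le> K'" "\<And>t. Q t \<Longrightarrow> Q' t"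
  shows "runs n vo io c s K' Q'"
  using assms unfolding runs_def by (meson order_trans)

lemma runs_Seq:
  assumes "runs n vo io c s K P" "\<And>t. P t \<Longrightarrow> runs n vo io d t L Q"
  shows "runs n vo io (Seq c d) s (K + L) Q"
  using assms unfolding runs_def by (meson exec.Seq add_mono)

section \<open>Loop-free programs: final state and cost\<close>

primrec straight_line :: "com \<Rightarrow> bool" where
  "straight_line Skip \<longleftrightarrow> True"
| "straight_line (NAssign x is e) \<longleftrightarrow> True"
| "straight_line (RAssign x is e) \<longleftrightarrow> True"
| "straight_line (ValueQuery x is a js) \<longleftrightarrow> True"
| "straight_line (IndepQuery x is a js) \<longleftrightarrow> True"
| "straight_line (Seq c d) \<longleftrightarrow> straight_line c \<and> straight_line d"
| "straight_line (IfElse b c d) \<longleftrightarrow> straight_line c \<and> straight_line d"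
| "straight_line (While b c) \<longleftrightarrow> False"

text \<open>Only an upper bound: the costs of both branches are added. The value for
  \<open>While\<close> is a placeholder.\<close>

primrec straight_cost :: "com \<Rightarrow> nat" where
  "straight_cost Skip = 1"
| "straight_cost (NAssign x is e) = 1"
| "straight_cost (RAssign x is e) = 1"
| "straight_cost (ValueQuery x is a js) = 1"
| "straight_cost (IndepQuery x is a js) = 1"
| "straight_cost (Seq c d) = straight_cost c + straight_cost d"
| "straight_cost (IfElse b c d) = 1 + straight_cost c + straight_cost d"
| "straight_cost (While b c) = 0"

text \<open>As a function, the final state can be computed by rewriting. It is meaningful for
  loop-free programs only; the clause for \<open>While\<close> is a placeholder.\<close>

primrec effect ::
  "nat \<Rightarrow> (nat set \<Rightarrow> real) \<Rightarrow> (nat set \<Rightarrow> bool) \<Rightarrow> com \<Rightarrow> state \<Rightarrow> state"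
where
  "effect n vo io Skip s = s"
| "effect n vo io (NAssign x is e) s = write_nat x (indices is s) (nval e s) s"
| "effect n vo io (RAssign x is e) s = write_real x (indices is s) (rval e s) s"
| "effect n vo io (ValueQuery x is a js) s =
     write_real x (indices is s) (vo (stored_set n s a (indices js s))) s"
| "effect n vo io (IndepQuery x is a js) s =
     write_nat x (indices is s) (if io (stored_set n s a (indices js s)) then 1 else 0) s"
| "effect n vo io (Seq c d) s = effect n vo io d (effect n vo io c s)"
| "effect n vo io (IfElse b c d) s = (if bval b s then effect n vo io c s else effect n vo io d s)"
| "effect n vo io (While b c) s = s"

lemma exec_straight_line:
  "straight_line c \<Longrightarrow> \<exists>k\<le>straight_cost c. exec n vo io c s k (effect n vo io c s)"
proof (induction c arbitrary: s)
  case (Seq c d)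
  then obtain k l where "k \<le> straight_cost c" "exec n vo io c s k (effect n vo io c s)"
    "l \<le> straight_cost d"
    "exec n vo io d (effect n vo io c s) l (effect n vo io d (effect n vo io c s))"
    by fastforce
  then show ?case by (intro exI[of _ "k + l"]) (auto intro: exec.Seq)
next
  case (IfElse b c d)
  show ?case
  proof (cases "bval b s")
    case True
    obtain k where "k \<le> straight_cost c" "exec n vo io c s k (effect n vo io c s)"
      using IfElse by fastforce
    then show ?thesis using True by (intro exI[of _ "1 + k"]) (auto intro: exec.IfTrue[simplified])
  next
    case False
    obtain k where "k \<le> straight_cost d" "exec n vo io d s k (effect n vo io d s)"
      using IfElse by fastforce
    then show ?thesis using False by (intro exI[of _ "1 + k"]) (auto intro: exec.IfFalse[simplified])
  qed
next
  case (IndepQuery x ys a zs)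
  show ?case unfolding effect.simps straight_cost.simps using exec.IndepQuery by blast
qed (auto intro: exec.intros simp del: One_nat_def intro!: exI[of _ 1])

lemma runs_straight_line:
  assumes "straight_line c" "straight_cost c \<le> K" "Q (effect n vo io c s)"
  shows "runs n vo io c s K Q"
  using exec_straight_line[OF assms(1)] assms(2,3) unfolding runs_def by (meson order_trans)

text \<open>The invariant counts iterations. A true guard forces \<open>k < T\<close>, so at most
  \<open>T - k\<close> iterations remain, each costing one test plus \<open>K\<close>; the final 1
  is the failing test.\<close>

lemma runs_While:
  assumes step: "\<And>k s. Inv k s \<Longrightarrow> bval b s \<Longrightarrow> k < T \<and> runs n vo io c s K (Inv (Suc k))"
  shows "Inv k s \<Longrightarrow> runs n vo io (While b c) s ((T - k) * (1 + K) + 1) (\<lambda>t. \<exists>k. Inv k t \<and> \<not> bval b t)"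
proof (induction "T - k" arbitrary: k s)
  case 0
  then have "\<not> bval b s" using step by fastforce
  then show ?case using 0 unfolding runs_def by (meson exec.WhileFalse le_add2)
next
  case (Suc m)
  show ?case
  proof (cases "bval b s")
    case False
    then show ?thesis using Suc.prems unfolding runs_def by (meson exec.WhileFalse le_add2)
  next
    case True
    then obtain l t where lt: "exec n vo io c s l t" "l \<le> K" "Inv (Suc k) t"
      using step[OF Suc.prems] unfolding runs_def by blast
    have m: "m = T - Suc k" using Suc.hyps(2) by simp
    obtain l' t' where lt': "exec n vo io (While b c) t l' t'" "l' \<le> m * (1 + K) + 1"
      "\<exists>k. Inv k t' \<and> \<not> bval b t'"
      using Suc.hyps(1)[OF m lt(3)] unfolding runs_def m by blast
    have "1 + l + l' \<le> (T - k) * (1 + K) + 1"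
      using lt(2) lt'(2) unfolding Suc.hyps(2)[symmetric] by simp
    then show ?thesis using exec.WhileTrue[OF True lt(1) lt'(1)] lt'(3) unfolding runs_def by blast
  qed
qed

section \<open>Memory after writes, and stored characteristic vectors\<close>

lemma nmem_write_nat [simp]:
  "nmem (write_nat x is w s) y js = (if y = x \<and> js = is then w else nmem s y js)"
  by (auto simp: write_nat_def)

lemma rmem_write_nat [simp]: "rmem (write_nat x is w s) = rmem s"
  by (simp add: write_nat_def)

lemma nmem_write_real [simp]: "nmem (write_real x is w s) = nmem s"
  by (simp add: write_real_def)

lemma rmem_write_real [simp]:
  "rmem (write_real x is w s) y js = (if y = x \<and> js = is then w else rmem s y js)"
  by (auto simp: write_real_def)

abbreviation marked :: "nat \<Rightarrow> state \<Rightarrow> vname \<Rightarrow> nat set" where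
  "marked n s a \<equiv> stored_set n s a []"

lemma marked_write_nat [simp]:
  "marked n (write_nat x [i] w s) y =
    (if y = x then if w = 0 then marked n s y - {i} else if i < n then insert i (marked n s y)
      else marked n s y else marked n s y)"
  by (auto simp: stored_set_def)

lemma marked_write_scalar [simp]: "marked n (write_nat x [] w s) y = marked n s y"
  by (auto simp: stored_set_def)

lemma marked_write_real [simp]: "marked n (write_real x is w s) y = marked n s y"
  by (auto simp: stored_set_def)

lemma marked_subset: "marked n s a \<subseteq> {..<n}"
  by (auto simp: stored_set_def)

lemma in_marked_iff: "i < n \<Longrightarrow> i \<in> marked n s a \<longleftrightarrow> 0 < nmem s a [i]"
  by (auto simp: stored_set_def)

abbreviation NVar :: "vname \<Rightarrow> nexp" where "NVar x \<equiv> NCell x []"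
abbreviation RVar :: "vname \<Rightarrow> rexp" where "RVar x \<equiv> RCell x []"
abbreviation RConst :: "nat \<Rightarrow> rexp" where "RConst m \<equiv> OfNat (NConst m)"

definition For :: "vname \<Rightarrow> com \<Rightarrow> com" where
  "For i c = Seq (NAssign i [] (NConst 0))
     (While (NLess (NVar i) (NVar ''n'')) (Seq c (NAssign i [] (NAdd (NVar i) (NConst 1)))))"

text \<open>The invariant is demanded after the counter has been advanced. Per round, 2 accounts for
  test and increment; the last 2 for initialization and the failing test.\<close>

lemma runs_For:
  assumes i: "i \<noteq> ''n''" and n: "nmem s ''n'' [] = n"
    and init: "Inv 0 (write_nat i [] 0 s)"
    and step: "\<And>k t. k < n \<Longrightarrow> Inv k t \<Longrightarrow> nmem t i [] = k \<Longrightarrow> nmem t ''n'' [] = n \<Longrightarrow>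
      runs n vo io c t K (\<lambda>u. Inv (Suc k) (write_nat i [] (Suc k) u) \<and> nmem u i [] = k \<and> nmem u ''n'' [] = n)"
  shows "runs n vo io (For i c) s (n * (K + 2) + 2) (\<lambda>t. Inv n t \<and> nmem t ''n'' [] = n)"
proof -
  let ?b = "NLess (NVar i) (NVar ''n'')" and ?inc = "NAssign i [] (NAdd (NVar i) (NConst 1))"
  let ?Inv = "\<lambda>k t. Inv k t \<and> nmem t i [] = k \<and> nmem t ''n'' [] = n \<and> k \<le> n"
  have "runs n vo io (While ?b (Seq c ?inc)) (write_nat i [] 0 s) ((n - 0) * (1 + (K + 1)) + 1)
      (\<lambda>t. \<exists>k. ?Inv k t \<and> \<not> bval ?b t)"
  proof (rule runs_While)
    show "?Inv 0 (write_nat i [] 0 s)" using i n init by auto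
    fix k t assume "?Inv k t" "bval ?b t"
    then have k: "k < n" and t: "Inv k t" "nmem t i [] = k" "nmem t ''n'' [] = n" by auto
    have "runs n vo io (Seq c ?inc) t (K + 1) (?Inv (Suc k))"
    proof (rule runs_Seq[OF step[OF k t]])
      fix u assume "Inv (Suc k) (write_nat i [] (Suc k) u) \<and> nmem u i [] = k \<and> nmem u ''n'' [] = n"
      then show "runs n vo io ?inc u 1 (?Inv (Suc k))"
        using i k by (intro runs_straight_line) auto
    qed
    then show "k < n \<and> runs n vo io (Seq c ?inc) t (K + 1) (?Inv (Suc k))" using k by blast
  qed
  then have "runs n vo io (For i c) s (1 + ((n - 0) * (1 + (K + 1)) + 1)) (\<lambda>t. \<exists>k. ?Inv k t \<and> \<not> bval ?b t)"
    unfolding For_def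
    by (intro runs_Seq[where P = "\<lambda>t. t = write_nat i [] 0 s"])
      (auto intro: runs_straight_line simp del: bval.simps)
  then show ?thesis by (rule runs_mono) auto
qed

section \<open>The algorithm\<close>

primrec block :: "com list \<Rightarrow> com" where
  "block [] = Skip"
| "block (c # cs) = Seq c (block cs)"

definition singleton_step :: com where
  "singleton_step = block [
     NAssign ''w'' [NVar ''i''] (NConst 1),
     IndepQuery ''ok'' [] ''w'' [],
     ValueQuery ''r'' [] ''w'' [],
     NAssign ''w'' [NVar ''i''] (NConst 0),
     IfElse (Conj (NLess (NConst 0) (NVar ''ok'')) (RLess (RVar ''M'') (RVar ''r'')))
       (RAssign ''M'' [] (RVar ''r'')) Skip]"

text \<open>The search starts with all of the greedy base in \<open>a\<close> and \<open>b\<close>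
  empty. The union is kept in \<open>out\<close> because the oracles only read stored
  vectors.\<close>

definition extend_step :: com where
  "extend_step = block [
     NAssign ''out'' [NVar ''i''] (NConst 1),
     IndepQuery ''ok'' [] ''out'' [],
     IfElse (NLess (NConst 0) (NVar ''ok''))
       (NAssign ''a'' [NVar ''i''] (NConst 1))
       (NAssign ''out'' [NVar ''i''] (NConst 0))]"

definition greedy_step :: com where
  "greedy_step = Seq singleton_step extend_step"

text \<open>The second conjunct says that \<open>v\<close> is outside \<open>out\<close> or equal to
  \<open>e\<close>, with equality expressed by two failed comparisons. The case \<open>v = e\<close>
  moves \<open>e\<close> between the two parts; it serves the elements fixed by the exchange
  bijection.\<close>

definition swap_admissible :: bexp where
  "swap_admissible = Conj (NLess (NConst 0) (NCell ''out'' [NVar ''e'']))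
     (Neg (Conj (NLess (NConst 0) (NCell ''out'' [NVar ''v'']))
       (Neg (Conj (Neg (NLess (NVar ''e'') (NVar ''v''))) (Neg (NLess (NVar ''v'') (NVar ''e'')))))))"

text \<open>The entries of \<open>e\<close> are cleared before those of \<open>v\<close> are set, so
  that \<open>v = e\<close> ends up in \<open>x\<close>. The old entries are saved since
  \<open>e\<close> may come from either part.\<close>

definition propose :: "vname \<Rightarrow> com" where
  "propose x = block [
     NAssign ''ae'' [] (NCell ''a'' [NVar ''e'']),
     NAssign ''be'' [] (NCell ''b'' [NVar ''e'']),
     NAssign ''a'' [NVar ''e''] (NConst 0),
     NAssign ''b'' [NVar ''e''] (NConst 0),
     NAssign ''out'' [NVar ''e''] (NConst 0),
     NAssign x [NVar ''v''] (NConst 1),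
     NAssign ''out'' [NVar ''v''] (NConst 1)]"

definition evaluate :: com where
  "evaluate = block [
     IndepQuery ''ok'' [] ''out'' [],
     ValueQuery ''fa'' [] ''a'' [],
     ValueQuery ''fb'' [] ''b'' [],
     ValueQuery ''fu'' [] ''out'' [],
     RAssign ''r'' [] (RAdd (RAdd (RMul (RConst 2) (RVar ''fa'')) (RMul (RConst 2) (RVar ''fb'')))
       (RMul (RConst 3) (RVar ''fu'')))]"

text \<open>The condition that \<open>r - cur\<close> exceeds \<open>M / (3 n)\<close>, multiplied
  out.\<close>

definition improving :: bexp where
  "improving = Conj (NLess (NConst 0) (NVar ''ok'')) (RLess (RVar ''M'')
     (RMul (RMul (RConst 3) (OfNat (NVar ''n''))) (RSub (RVar ''r'') (RVar ''cur''))))"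

definition accept :: com where
  "accept = block [RAssign ''cur'' [] (RVar ''r''), NAssign ''go'' [] (NConst 1)]"

text \<open>The writes for \<open>v\<close> are reverted first, so that the restored entries of
  \<open>e\<close> survive when \<open>v = e\<close>.\<close>

definition undo :: "vname \<Rightarrow> com" where
  "undo x = block [
     NAssign x [NVar ''v''] (NConst 0),
     NAssign ''out'' [NVar ''v''] (NConst 0),
     NAssign ''a'' [NVar ''e''] (NVar ''ae''),
     NAssign ''b'' [NVar ''e''] (NVar ''be''),
     NAssign ''out'' [NVar ''e''] (NConst 1)]"

definition swap_step :: "vname \<Rightarrow> com" where
  "swap_step x = IfElse swap_admissible
     (Seq (propose x) (Seq evaluate (IfElse improving accept (undo x)))) Skip"

definition local_search_pass :: com where
  "local_search_pass = For ''e'' (For ''v'' (Seq (swap_step ''a'') (swap_step ''b'')))"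

text \<open>\<open>go\<close> records whether a pass accepted an exchange. A pass without one has
  tested all pairs against the same two sets.\<close>

definition local_search :: com where
  "local_search = Seq (For ''i'' greedy_step) (Seq (NAssign ''go'' [] (NConst 1))
     (While (NLess (NConst 0) (NVar ''go''))
       (Seq (NAssign ''go'' [] (NConst 0)) local_search_pass)))"

text \<open>The oracle is tied to \<open>Ind\<close> only on subsets of the index range: the real
  oracle tests an image under list indexing, which is unspecified beyond the list.\<close>

locale indexed_problem = submodular_matroid "{..<n}" Ind f
  for n :: nat and Ind f +
  fixes io :: "nat set \<Rightarrow> bool"
  assumes io_iff: "X \<subseteq> {..<n} \<Longrightarrow> io X \<longleftrightarrow> X \<in> Ind"
begin

lemma io_marked [simp]: "io (marked n s x) \<longleftrightarrow> marked n s x \<in> Ind"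
  by (rule io_iff) (rule marked_subset)

lemma potential_commute: "potential A B = potential B A"
  by (simp add: potential_def Un_commute)

section \<open>Greedy phase: an initial base and the scale of the values\<close>

definition greedy_inv :: "nat \<Rightarrow> state \<Rightarrow> bool" where
  "greedy_inv k s \<longleftrightarrow> marked n s ''w'' = {} \<and> marked n s ''b'' = {} \<and>
     marked n s ''a'' = marked n s ''out'' \<and> marked n s ''out'' \<in> Ind \<and>
     (\<forall>j<k. j \<notin> marked n s ''out'' \<longrightarrow> insert j (marked n s ''out'') \<notin> Ind) \<and>
     rmem s ''cur'' [] = 0 \<and>
     (rmem s ''M'' [] = 0 \<or> (\<exists>u. {u} \<in> Ind \<and> rmem s ''M'' [] = f {u})) \<and>
     0 \<le> rmem s ''M'' [] \<and> (\<forall>j<k. {j} \<in> Ind \<longrightarrow> f {j} \<le> rmem s ''M'' [])"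

text \<open>The bound 14 is the sum of the straight-line costs 8 and 6 of the two halves.\<close>

lemma greedy_step_correct:
  assumes "greedy_inv k s" "k < n" "nmem s ''i'' [] = k" "nmem s ''n'' [] = n"
  shows "runs n f io greedy_step s 14
    (\<lambda>t. greedy_inv (Suc k) (write_nat ''i'' [] (Suc k) t) \<and> nmem t ''i'' [] = k \<and> nmem t ''n'' [] = n)"
proof (rule runs_straight_line)
  let ?t = "effect n f io greedy_step s"
  let ?U = "marked n s ''out''" and ?M = "rmem s ''M'' []"
  let ?M' = "if {k} \<in> Ind \<and> ?M < f {k} then f {k} else ?M"
  let ?U' = "if insert k ?U \<in> Ind then insert k ?U else ?U"
  have io: "io {k} \<longleftrightarrow> {k} \<in> Ind" "io (insert k ?U) \<longleftrightarrow> insert k ?U \<in> Ind"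
    using assms(2) marked_subset by (auto intro!: io_iff)
  have U: "?U \<in> Ind" using assms(1) by (simp add: greedy_inv_def)
  have inv: "marked n s ''w'' = {}" "marked n s ''b'' = {}" "marked n s ''a'' = ?U" "rmem s ''cur'' [] = 0"
    using assms(1) by (simp_all add: greedy_inv_def)
  have t: "nmem ?t ''i'' [] = k" "nmem ?t ''n'' [] = n" "marked n ?t ''w'' = {}"
    "marked n ?t ''b'' = {}" "marked n ?t ''out'' = ?U'" "marked n ?t ''a'' = ?U'"
    "rmem ?t ''cur'' [] = 0" "rmem ?t ''M'' [] = ?M'"
  proof -
    let ?s = "effect n f io singleton_step s"
    have s: "nmem ?s ''i'' [] = k" "nmem ?s ''n'' [] = n" "marked n ?s ''w'' = {}"
      "marked n ?s ''b'' = {}" "marked n ?s ''out'' = ?U" "marked n ?s ''a'' = ?U"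
      "rmem ?s ''cur'' [] = 0" "rmem ?s ''M'' [] = ?M'"
      by (cases "{k} \<in> Ind \<and> ?M < f {k}"; simp add: singleton_step_def inv io(1) assms(2-4))+
    have t: "?t = effect n f io extend_step ?s" by (simp add: greedy_step_def)
    show "nmem ?t ''i'' [] = k" "nmem ?t ''n'' [] = n" "marked n ?t ''w'' = {}"
      "marked n ?t ''b'' = {}" "marked n ?t ''out'' = ?U'" "marked n ?t ''a'' = ?U'"
      "rmem ?t ''cur'' [] = 0" "rmem ?t ''M'' [] = ?M'"
      unfolding t using U
      by (cases "insert k ?U \<in> Ind"; cases "k \<in> ?U";
          simp add: extend_step_def s io(2) assms(2) insert_absorb)+
  qed
  \<comment> \<open>An element refused earlier stays refused because the set only grows and subsets
    of independent sets are independent.\<close>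
  have "j \<notin> ?U' \<longrightarrow> insert j ?U' \<notin> Ind" if "j < Suc k" for j
  proof -
    have "j \<notin> ?U \<longrightarrow> insert j ?U \<notin> Ind" if "j < k"
      using assms(1) that by (simp add: greedy_inv_def)
    then show ?thesis using that indep_subset[of "insert j (insert k ?U)" "insert j ?U"]
      by (auto simp: less_Suc_eq)
  qed
  moreover have "\<forall>j<Suc k. {j} \<in> Ind \<longrightarrow> f {j} \<le> ?M'"
  proof (intro allI impI)
    fix j assume j: "j < Suc k" "{j} \<in> Ind"
    have "f {j} \<le> ?M" if "j < k" using assms(1) that j(2) by (simp add: greedy_inv_def)
    then show "f {j} \<le> ?M'" using j by (cases "j = k") auto
  qed
  moreover have "0 \<le> ?M'" "?M' = 0 \<or> (\<exists>u. {u} \<in> Ind \<and> ?M' = f {u})"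
    using assms(1) by (auto simp: greedy_inv_def)
  ultimately show "greedy_inv (Suc k) (write_nat ''i'' [] (Suc k) ?t) \<and>
      nmem ?t ''i'' [] = k \<and> nmem ?t ''n'' [] = n"
    using U unfolding greedy_inv_def by (simp add: t)
qed (simp_all add: greedy_step_def singleton_step_def extend_step_def)

text \<open>The upper bound limits the number of exchanges; being 0 or attained keeps
  \<open>M\<close> below the optimum, so that the slack costs only a fraction of it.\<close>

definition scale :: "real \<Rightarrow> bool" where
  "scale M \<longleftrightarrow> 0 \<le> M \<and> (\<forall>u. {u} \<in> Ind \<longrightarrow> f {u} \<le> M) \<and> (M = 0 \<or> (\<exists>u. {u} \<in> Ind \<and> M = f {u}))"

text \<open>\<open>cur\<close> is only a lower bound for the potential: it starts at 0 and becomes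
  exact with the first accepted exchange. This keeps \<open>7 * (real n * M)\<close> valid even if
  the base is empty and \<open>f {}\<close> is positive.\<close>

definition search_inv :: "real \<Rightarrow> state \<Rightarrow> bool" where
  "search_inv M s \<longleftrightarrow> nmem s ''n'' [] = n \<and> rmem s ''M'' [] = M \<and>
     marked n s ''a'' \<inter> marked n s ''b'' = {} \<and>
     marked n s ''out'' = marked n s ''a'' \<union> marked n s ''b'' \<and> base (marked n s ''out'') \<and>
     0 \<le> rmem s ''cur'' [] \<and> rmem s ''cur'' [] \<le> 7 * (real n * M) \<and>
     rmem s ''cur'' [] \<le> potential (marked n s ''a'') (marked n s ''b'')"

lemma greedy_inv_search_inv:
  assumes "greedy_inv n s" "nmem s ''n'' [] = n"
  shows "\<exists>M. scale M \<and> search_inv M s"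
proof (intro exI conjI)
  let ?U = "marked n s ''out''" and ?M = "rmem s ''M'' []"
  have U: "?U \<in> Ind" using assms(1) by (simp add: greedy_inv_def)
  have max: "card T \<le> card ?U" if T: "T \<in> Ind" for T
  proof (rule ccontr)
    assume "\<not> ?thesis"
    then obtain u where u: "u \<in> T - ?U" "?U \<union> {u} \<in> Ind"
      using indep_augment[OF U T] by auto
    moreover have "u < n" using u(1) indep_subset_ground[OF T] by auto
    ultimately show False using assms(1) by (auto simp: greedy_inv_def)
  qed
  have M: "0 \<le> ?M" using assms(1) by (simp add: greedy_inv_def)
have "f {u} \<le> ?M" if "{u} \<in> Ind" for u
    using assms(1) indep_subset_ground[OF that] that by (auto simp: greedy_inv_def)
  then show "scale ?M" using assms(1) by (auto simp: scale_def greedy_inv_def)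
  have "0 \<le> potential ?U {}"
    using nonneg[of "{}"] nonneg[of ?U] marked_subset by (simp add: potential_def)
  then show "search_inv ?M s"
    using assms M U max by (simp add: search_inv_def greedy_inv_def base_def)
qed

text \<open>Local optimality for inserting \<open>v\<close> into the first part, measured against a
  value \<open>c\<close> of \<open>cur\<close> instead of the potential.\<close>

definition rejected :: "nat set \<Rightarrow> nat set \<Rightarrow> real \<Rightarrow> real \<Rightarrow> nat \<Rightarrow> nat \<Rightarrow> bool" where
  "rejected A B c M e v \<longleftrightarrow>
     (e \<in> A \<union> B \<longrightarrow> v \<notin> A \<union> B - {e} \<longrightarrow> insert v (A \<union> B - {e}) \<in> Ind \<longrightarrow>
       3 * real n * (potential (insert v (A - {e})) (B - {e}) - c) \<le> M)"

text \<open>The set \<open>x\<close> receives \<open>v\<close> and \<open>y\<close> is the other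
  part, which treats both directions at once. Either \<open>cur\<close> rises by more than the
  threshold, or both parts are unchanged and the pair is certified as rejected.\<close>

lemma swap_step_correct:
  assumes inv: "search_inv M s" and M: "scale M"
    and ev: "nmem s ''e'' [] = e" "nmem s ''v'' [] = v" "e < n" "v < n"
    and xy: "(x, y) = (''a'', ''b'') \<or> (x, y) = (''b'', ''a'')"
  defines "t \<equiv> effect n f io (swap_step x) s"
  shows "search_inv M t" "nmem t ''e'' [] = e" "nmem t ''v'' [] = v"
    "nmem t ''go'' [] = 1 \<and> M < 3 * real n * (rmem t ''cur'' [] - rmem s ''cur'' []) \<or>
     nmem t ''go'' [] = nmem s ''go'' [] \<and> rmem t ''cur'' [] = rmem s ''cur'' [] \<and>
     marked n t ''a'' = marked n s ''a'' \<and> marked n t ''b'' = marked n s ''b'' \<and>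
     rejected (marked n s x) (marked n s y) (rmem s ''cur'' []) M e v"
proof -
  let ?A = "marked n s ''a''" and ?B = "marked n s ''b''" and ?c = "rmem s ''cur'' []"
  let ?X = "marked n s x" and ?Y = "marked n s y"
  let ?U = "insert v (?X \<union> ?Y - {e})"
  let ?p = "potential (insert v (?X - {e})) (?Y - {e})"
  from xy have xy: "x = ''a'' \<and> y = ''b'' \<or> x = ''b'' \<and> y = ''a''" by simp
  have N: "?X \<subseteq> {..<n}" "?Y \<subseteq> {..<n}" by (simp_all add: marked_subset)
  have disj: "?X \<inter> ?Y = {}"
    and out: "marked n s ''out'' = ?X \<union> ?Y"
    using xy inv by (auto simp: search_inv_def)
  have n: "nmem s ''n'' [] = n" "rmem s ''M'' [] = M" using inv by (simp_all add: search_inv_def)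
  have base: "base (?X \<union> ?Y)" using inv out unfolding search_inv_def by metis
  have io: "io ?U \<longleftrightarrow> ?U \<in> Ind" using N ev by (intro io_iff) auto
  have adm: "bval swap_admissible s \<longleftrightarrow> e \<in> ?X \<union> ?Y \<and> v \<notin> ?X \<union> ?Y - {e}"
  proof -
    have "0 < nmem s ''out'' [j] \<longleftrightarrow> j \<in> ?X \<union> ?Y" if "j < n" for j
      using in_marked_iff[OF that, of s "''out''"] out by simp
    then show ?thesis using ev(3,4) by (auto simp: swap_admissible_def ev(1,2))
  qed
  have mem: "nmem s ''a'' [e] = 0 \<longleftrightarrow> e \<notin> ?A" "nmem s ''b'' [e] = 0 \<longleftrightarrow> e \<notin> ?B"
    using ev(3) by (simp_all add: in_marked_iff)
  define s1 where "s1 = effect n f io (propose x) s"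
  define s2 where "s2 = effect n f io evaluate s1"
  have s1: "marked n s1 x = insert v (?X - {e})" "marked n s1 y = ?Y - {e}"
    "marked n s1 ''out'' = insert v (?X \<union> ?Y - {e})"
    "nmem s1 ''ae'' [] = nmem s ''a'' [e]" "nmem s1 ''be'' [] = nmem s ''b'' [e]"
    "nmem s1 ''e'' [] = e" "nmem s1 ''v'' [] = v" "nmem s1 ''n'' [] = n"
    "nmem s1 ''go'' [] = nmem s ''go'' []" "rmem s1 = rmem s"
    using xy unfolding s1_def by (elim disjE conjE; simp add: propose_def ev n out)+
  have "2 * f (marked n s1 ''a'') + 2 * f (marked n s1 ''b'') + 3 * f ?U = ?p"
  proof -
    have "insert v (?X - {e}) \<union> (?Y - {e}) = ?U" by auto
    then show ?thesis using xy s1(1,2) by (auto simp: potential_def)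
  qed
  then have s2: "\<And>z. marked n s2 z = marked n s1 z" "\<And>z. z \<noteq> ''ok'' \<Longrightarrow> nmem s2 z = nmem s1 z"
    "nmem s2 ''ok'' [] = (if ?U \<in> Ind then 1 else 0)"
    "rmem s2 ''r'' [] = ?p" "rmem s2 ''M'' [] = M" "rmem s2 ''cur'' [] = ?c"
    using io n s1(3,10) by (auto simp: s2_def evaluate_def)
  have improving: "bval improving s2 \<longleftrightarrow> ?U \<in> Ind \<and> M < 3 * real n * (?p - ?c)"
    using s1 s2 by (simp add: improving_def)
  have t: "t = (if bval swap_admissible s then
      if bval improving s2 then effect n f io accept s2 else effect n f io (undo x) s2 else s)"
    by (simp add: t_def swap_step_def s1_def s2_def)
  consider (skip) "\<not> bval swap_admissible s"
    | (accept) "bval swap_admissible s" "?U \<in> Ind" "M < 3 * real n * (?p - ?c)"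
    | (reject) "bval swap_admissible s" "\<not> (?U \<in> Ind \<and> M < 3 * real n * (?p - ?c))"
    by blast
  then have "search_inv M t \<and> nmem t ''e'' [] = e \<and> nmem t ''v'' [] = v \<and>
    (nmem t ''go'' [] = 1 \<and> M < 3 * real n * (rmem t ''cur'' [] - ?c) \<or>
     nmem t ''go'' [] = nmem s ''go'' [] \<and> rmem t ''cur'' [] = ?c \<and>
     marked n t ''a'' = ?A \<and> marked n t ''b'' = ?B \<and> rejected ?X ?Y ?c M e v)"
  proof cases
    case skip
    then have "t = s" by (simp add: t_def swap_step_def)
    then show ?thesis using skip inv ev adm by (auto simp: rejected_def)
  next
    case accept
    have t: "nmem t ''e'' [] = e" "nmem t ''v'' [] = v" "nmem t ''n'' [] = n" "nmem t ''go'' [] = 1"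
      "rmem t ''M'' [] = M" "rmem t ''cur'' [] = ?p" "marked n t ''out'' = ?U"
      "marked n t x = insert v (?X - {e})" "marked n t y = ?Y - {e}"
      using accept improving s1 s2 by (simp_all add: t accept_def)
    have "card ?U = card (?X \<union> ?Y)"
      using accept(1) N adm card_Suc_Diff1[of "?X \<union> ?Y" e] finite_subset[OF N(1)] finite_subset[OF N(2)]
      by auto
    then have "base ?U" using base accept(2) by (simp add: base_def)
    have Ueq: "insert v (?X - {e}) \<union> (?Y - {e}) = ?U" by auto
    have "0 \<le> M" using M by (simp add: scale_def)
    then have "0 < 3 * real n * (?p - ?c)" using accept(3) by linarith
    then have "?c < ?p" by (simp add: zero_less_mult_iff)
    moreover have "0 \<le> ?c" using inv by (simp add: search_inv_def)
    moreover have "?U \<subseteq> {..<n}" using N ev by auto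
    then have "?p \<le> 7 * f ?U" using potential_le[of "insert v (?X - {e})" "?Y - {e}"] unfolding Ueq by blast
    \<comment> \<open>\<open>?U\<close> contains \<open>v\<close>, so the bound for nonempty
      independent sets applies. With the factor 7 it keeps \<open>cur\<close> in range.\<close>
    moreover have "f ?U \<le> real n * M"
      using le_card_times_singleton[OF accept(2), of M] M by (auto simp: scale_def)
    moreover have "insert v (?X - {e}) \<inter> (?Y - {e}) = {}"
      using disj adm accept(1) by auto
    ultimately have "search_inv M t"
      using xy t Ueq \<open>base ?U\<close>
      by (auto simp: search_inv_def potential_commute Un_commute Int_commute)
    then show ?thesis using t accept(3) by simp
  next
    case reject
    have t': "marked n t ''a'' = ?A \<and> marked n t ''b'' = ?B \<and> marked n t ''out'' = marked n s ''out'' \<and>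
      nmem t ''e'' [] = e \<and> nmem t ''v'' [] = v \<and> nmem t ''n'' [] = n \<and>
      nmem t ''go'' [] = nmem s ''go'' [] \<and> rmem t ''M'' [] = M \<and> rmem t ''cur'' [] = ?c"
    proof -
      have "\<not> bval improving s2" using reject improving by blast
      then have t: "t = effect n f io (undo x) s2" using reject(1) by (simp add: t)
      have ev': "e \<in> ?X \<union> ?Y" "v \<notin> ?X \<union> ?Y - {e}" using reject adm by auto
      note facts = s1 s2 out
      have "marked n t x = (if e \<in> ?X then insert e (insert v (?X - {e}) - {v})
            else insert v (?X - {e}) - {v} - {e}) \<and>
          marked n t y = (if e \<in> ?Y then insert e (?Y - {e}) else ?Y - {e} - {e}) \<and>
          marked n t ''out'' = insert e (?U - {v}) \<and>
          nmem t ''e'' [] = e \<and> nmem t ''v'' [] = v \<and> nmem t ''n'' [] = n \<and>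
          nmem t ''go'' [] = nmem s ''go'' [] \<and> rmem t ''M'' [] = M \<and> rmem t ''cur'' [] = ?c"
        using xy
      proof (elim disjE conjE)
        assume xy: "x = ''a''" "y = ''b''"
        show ?thesis unfolding t xy by (simp add: undo_def ev mem facts[unfolded xy])
      next
        assume xy: "x = ''b''" "y = ''a''"
        show ?thesis unfolding t xy by (simp add: undo_def ev mem facts[unfolded xy])
      qed
      \<comment> \<open>Admissibility makes the nested updates collapse: \<open>v\<close> was in
        neither part unless it equals \<open>e\<close>, and \<open>e\<close> was in the
        union.\<close>
      moreover have "(if e \<in> ?X then insert e (insert v (?X - {e}) - {v})
          else insert v (?X - {e}) - {v} - {e}) = ?X"
        "(if e \<in> ?Y then insert e (?Y - {e}) else ?Y - {e} - {e}) = ?Y"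
        "insert e (?U - {v}) = ?X \<union> ?Y"
        using ev' by auto
      ultimately show ?thesis using xy unfolding out by metis
    qed
    then have "search_inv M t \<longleftrightarrow> search_inv M s" unfolding search_inv_def by (simp only: n)
    moreover have "rejected ?X ?Y ?c M e v" using reject(2) by (auto simp: rejected_def)
    ultimately show ?thesis using t' inv by simp
  qed
  then show "search_inv M t" "nmem t ''e'' [] = e" "nmem t ''v'' [] = v"
    "nmem t ''go'' [] = 1 \<and> M < 3 * real n * (rmem t ''cur'' [] - ?c) \<or>
     nmem t ''go'' [] = nmem s ''go'' [] \<and> rmem t ''cur'' [] = ?c \<and>
     marked n t ''a'' = ?A \<and> marked n t ''b'' = ?B \<and> rejected ?X ?Y ?c M e v"
    by auto
qed

text \<open>
  \<open>pass_inv M c D s\<close>: a pass entered with value \<open>c\<close> of \<open>cur\<close> has processed the pairs in \<open>D\<close>.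
\<close>

definition pass_inv :: "real \<Rightarrow> real \<Rightarrow> (nat \<times> nat) set \<Rightarrow> state \<Rightarrow> bool" where
  "pass_inv M c D s \<longleftrightarrow> search_inv M s \<and>
     (nmem s ''go'' [] = 0 \<and> rmem s ''cur'' [] = c \<and>
        (\<forall>(e, v) \<in> D. rejected (marked n s ''a'') (marked n s ''b'') c M e v \<and>
          rejected (marked n s ''b'') (marked n s ''a'') c M e v) \<or>
      nmem s ''go'' [] = 1 \<and> M < 3 * real n * (rmem s ''cur'' [] - c))"

lemma pass_inv_swap_step:
  assumes inv: "pass_inv M c D s" and M: "scale M"
    and ev: "nmem s ''e'' [] = e" "nmem s ''v'' [] = v" "e < n" "v < n"
  defines "t \<equiv> effect n f io (Seq (swap_step ''a'') (swap_step ''b'')) s"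
  shows "pass_inv M c (insert (e, v) D) t" "nmem t ''e'' [] = e" "nmem t ''v'' [] = v"
proof -
  define u where "u = effect n f io (swap_step ''a'') s"
  have t: "t = effect n f io (swap_step ''b'') u" by (simp add: t_def u_def)
  have s: "search_inv M s" using inv by (simp add: pass_inv_def)
  note u = swap_step_correct[OF s M ev, of "''a''" "''b''", folded u_def, simplified]
  note t' = swap_step_correct[OF u(1) M u(2,3) ev(3,4), of "''b''" "''a''", folded t, simplified]
  \<comment> \<open>If both directions are accepted, the two increases of \<open>cur\<close> add up;
    nonnegativity of \<open>M\<close> keeps the sum above one threshold.\<close>
  have "0 \<le> M" using M by (simp add: scale_def)
  then show "pass_inv M c (insert (e, v) D) t"
    using inv t'(1,4) u(4) unfolding pass_inv_def right_diff_distrib by auto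
  show "nmem t ''e'' [] = e" "nmem t ''v'' [] = v" using t' by auto
qed

section \<open>Passes over all pairs of elements\<close>

lemma search_inv_write_scalar:
  "x \<noteq> ''n'' \<Longrightarrow> search_inv M (write_nat x [] k s) \<longleftrightarrow> search_inv M s"
  by (simp add: search_inv_def)

lemma pass_inv_write_scalar:
  assumes "x \<noteq> ''n''" "x \<noteq> ''go''"
  shows "pass_inv M c D (write_nat x [] k s) \<longleftrightarrow> pass_inv M c D s"
  using assms by (simp add: pass_inv_def search_inv_write_scalar)

lemma local_search_pass_correct:
  assumes "pass_inv M c {} s" "scale M"
  shows "runs n f io local_search_pass s (n * (n * 54 + 4) + 2) (pass_inv M c ({..<n} \<times> {..<n}))"
proof -
  have n: "nmem s ''n'' [] = n" using assms by (simp add: pass_inv_def search_inv_def)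
  \<comment> \<open>The pairs that precede \<open>(i, j)\<close> in lexicographic order.\<close>
  let ?D = "\<lambda>i j. {..<i} \<times> {..<n} \<union> {i} \<times> {..<j}"
  \<comment> \<open>Each of the two \<open>swap_step\<close> programs has straight-line cost 26,
    hence 52.\<close>
  have inner: "runs n f io (For ''v'' (Seq (swap_step ''a'') (swap_step ''b''))) t (n * (52 + 2) + 2)
    (\<lambda>u. pass_inv M c (?D k n) u \<and> nmem u ''e'' [] = k \<and> nmem u ''n'' [] = n)"
    if t: "pass_inv M c ({..<k} \<times> {..<n}) t" "nmem t ''e'' [] = k" "nmem t ''n'' [] = n" "k < n" for k t
  proof -
    have "runs n f io (For ''v'' (Seq (swap_step ''a'') (swap_step ''b''))) t (n * (52 + 2) + 2)
      (\<lambda>u. (pass_inv M c (?D k n) u \<and> nmem u ''e'' [] = k) \<and> nmem u ''n'' [] = n)"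
    proof (rule runs_For[where Inv = "\<lambda>l u. pass_inv M c (?D k l) u \<and> nmem u ''e'' [] = k"])
      fix l u
      assume *: "l < n" "pass_inv M c (?D k l) u \<and> nmem u ''e'' [] = k" "nmem u ''v'' [] = l"
      have D: "?D k (Suc l) = insert (k, l) (?D k l)" by (auto simp: less_Suc_eq)
      note p = pass_inv_swap_step[of M c "?D k l" u k l]
      show "runs n f io (Seq (swap_step ''a'') (swap_step ''b'')) u 52
          (\<lambda>w. (pass_inv M c (?D k (Suc l)) (write_nat ''v'' [] (Suc l) w) \<and>
                nmem (write_nat ''v'' [] (Suc l) w) ''e'' [] = k) \<and>
               nmem w ''v'' [] = l \<and> nmem w ''n'' [] = n)"
      proof (rule runs_straight_line)
        let ?w = "effect n f io (Seq (swap_step ''a'') (swap_step ''b'')) u"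
        have w: "pass_inv M c (?D k (Suc l)) ?w" "nmem ?w ''e'' [] = k" "nmem ?w ''v'' [] = l"
          using p * assms(2) t(4) unfolding D by auto
        moreover have "nmem ?w ''n'' [] = n" using w(1) by (simp add: pass_inv_def search_inv_def)
        ultimately show "(pass_inv M c (?D k (Suc l)) (write_nat ''v'' [] (Suc l) ?w) \<and>
              nmem (write_nat ''v'' [] (Suc l) ?w) ''e'' [] = k) \<and>
             nmem ?w ''v'' [] = l \<and> nmem ?w ''n'' [] = n"
          by (simp add: pass_inv_write_scalar del: effect.simps)
      qed (simp_all add: swap_step_def propose_def evaluate_def accept_def undo_def)
    qed (use t in \<open>auto simp: pass_inv_write_scalar\<close>)
    then show ?thesis by simp
  qed
  have "runs n f io local_search_pass s (n * ((n * (52 + 2) + 2) + 2) + 2)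
      (\<lambda>t. pass_inv M c ({..<n} \<times> {..<n}) t \<and> nmem t ''n'' [] = n)"
    unfolding local_search_pass_def
  proof (rule runs_For[where Inv = "\<lambda>k. pass_inv M c ({..<k} \<times> {..<n})"])
    show "pass_inv M c ({..<0} \<times> {..<n}) (write_nat ''e'' [] 0 s)"
      using assms(1) by (simp add: pass_inv_write_scalar)
    fix k t
    assume *: "k < n" "pass_inv M c ({..<k} \<times> {..<n}) t" "nmem t ''e'' [] = k" "nmem t ''n'' [] = n"
    have "?D k n = {..<Suc k} \<times> {..<n}" by (auto simp: less_Suc_eq)
    then show "runs n f io (For ''v'' (Seq (swap_step ''a'') (swap_step ''b''))) t (n * (52 + 2) + 2)
        (\<lambda>u. pass_inv M c ({..<Suc k} \<times> {..<n}) (write_nat ''e'' [] (Suc k) u) \<and>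
          nmem u ''e'' [] = k \<and> nmem u ''n'' [] = n)"
      using inner[OF *(2-4,1)] by (simp add: pass_inv_write_scalar)
  qed (use n in auto)
  then show ?thesis by (rule runs_mono) (auto simp: algebra_simps)
qed

section \<open>Number of passes and approximation ratio\<close>

definition outer_inv :: "real \<Rightarrow> nat \<Rightarrow> state \<Rightarrow> bool" where
  "outer_inv M k s \<longleftrightarrow> search_inv M s \<and>
     (nmem s ''go'' [] = 1 \<and> (k = 0 \<or> real k * M < 3 * real n * rmem s ''cur'' []) \<or>
      nmem s ''go'' [] = 0 \<and> (\<forall>e<n. \<forall>v<n.
        rejected (marked n s ''a'') (marked n s ''b'') (rmem s ''cur'' []) M e v \<and>
        rejected (marked n s ''b'') (marked n s ''a'') (rmem s ''cur'' []) M e v))"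

text \<open>Every pass that leaves \<open>go\<close> set raises \<open>3 * real n * cur\<close> by
  more than \<open>M\<close>, and \<open>cur\<close> is at most \<open>7 * (real n * M)\<close>;
  this gives 21 times the square of \<open>n\<close>. The extra 1 admits the first pass when
  \<open>n\<close> is 0.\<close>

lemma outer_inv_step:
  assumes inv: "outer_inv M k s" and M: "scale M" and go: "0 < nmem s ''go'' []"
  shows "k < 21 * n\<^sup>2 + 1" (is ?bound)
    and "runs n f io (Seq (NAssign ''go'' [] (NConst 0)) local_search_pass) s
      (n * (n * 54 + 4) + 3) (outer_inv M (Suc k))" (is ?run)
proof -
  let ?c = "rmem s ''cur'' []"
  have s: "search_inv M s" and k: "k = 0 \<or> real k * M < 3 * real n * ?c"
    using inv go by (auto simp: outer_inv_def)
  have c: "0 \<le> ?c" "?c \<le> 7 * (real n * M)" using s by (simp_all add: search_inv_def)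
  have M0: "0 \<le> M" using M by (simp add: scale_def)
  show ?bound
  proof (cases "k = 0")
    case False
    then have "real k * M < 3 * real n * ?c" using k by simp
    also have "\<dots> \<le> 3 * real n * (7 * (real n * M))" using c by (intro mult_left_mono) auto
    also have "\<dots> = real (21 * n\<^sup>2) * M" by (simp add: power2_eq_square)
    \<comment> \<open>Strictness of the product inequality excludes \<open>M = 0\<close>, so
      \<open>M\<close> can be cancelled.\<close>
    finally have "real k < real (21 * n\<^sup>2)" using M0 by (simp add: mult_less_cancel_right)
    then show ?thesis by linarith
  qed simp
  have "pass_inv M ?c {} (write_nat ''go'' [] 0 s)"
    using s by (simp add: pass_inv_def search_inv_write_scalar)
  note pass = local_search_pass_correct[OF this M]
  have "runs n f io (Seq (NAssign ''go'' [] (NConst 0)) local_search_pass) s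
      (1 + (n * (n * 54 + 4) + 2)) (pass_inv M ?c ({..<n} \<times> {..<n}))"
    by (rule runs_Seq[where P = "\<lambda>t. t = write_nat ''go'' [] 0 s"])
      (use pass in \<open>auto intro: runs_straight_line\<close>)
  then show ?run
  proof (rule runs_mono)
    fix t assume t: "pass_inv M ?c ({..<n} \<times> {..<n}) t"
    have "real (Suc k) * M < 3 * real n * rmem t ''cur'' []"
      if "M < 3 * real n * (rmem t ''cur'' [] - ?c)"
    proof -
      have "real k * M \<le> 3 * real n * ?c" using k c by auto
      then show ?thesis using that by (simp add: algebra_simps)
    qed
    then show "outer_inv M (Suc k) t" using t by (auto simp: outer_inv_def pass_inv_def)
  qed simp
qed

lemma outer_inv_approximation:
  assumes inv: "outer_inv M k s" and M: "scale M" and go: "nmem s ''go'' [] = 0" and S: "S \<in> Ind"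
  shows "0.5008 * f S \<le> f (marked n s ''out'')"
proof -
  let ?A = "marked n s ''a''" and ?B = "marked n s ''b''" and ?c = "rmem s ''cur'' []"
  have s: "search_inv M s" using inv by (simp add: outer_inv_def)
  have out: "marked n s ''out'' = ?A \<union> ?B" and disj: "?A \<inter> ?B = {}"
    and "base (marked n s ''out'')" and c: "?c \<le> potential ?A ?B"
    using s unfolding search_inv_def by blast+
  then have base: "base (?A \<union> ?B)" by simp
  have M0: "0 \<le> M" using M by (simp add: scale_def)
  define \<theta> where "\<theta> = M / (3 * real n)"
  \<comment> \<open>Since \<open>cur\<close> is at most the potential, rejection against
    \<open>cur\<close> implies optimality up to \<open>\<theta>\<close> for the potential. Generic
    sets allow a second use with the parts interchanged.\<close>
  have opt: "potential (insert v (A - {e})) (B - {e}) \<le> potential A B + \<theta>"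
    if "A \<union> B = ?A \<union> ?B" "potential A B = potential ?A ?B"
      "e < n \<Longrightarrow> v < n \<Longrightarrow> rejected A B ?c M e v"
      "e \<in> A \<union> B" "v \<notin> A \<union> B - {e}" "insert v (A \<union> B - {e}) \<in> Ind" for A B e v
  proof -
    have "e \<in> {..<n}" using that(1,4) marked_subset by blast
    moreover have "v \<in> {..<n}" using indep_subset_ground[OF that(6)] by blast
    ultimately have "3 * real n * (potential (insert v (A - {e})) (B - {e}) - ?c) \<le> M" and n: "0 < real n"
      using that(3-6) by (auto simp: rejected_def)
    then have "potential (insert v (A - {e})) (B - {e}) - ?c \<le> \<theta>"
      by (simp add: \<theta>_def field_simps)
    then show ?thesis using c that(2) by linarith
  qed
  have rej: "rejected ?A ?B ?c M e v" "rejected ?B ?A ?c M e v" if "e < n" "v < n" for e v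
    using inv go that by (auto simp: outer_inv_def)
  have "Max (f ` Ind) \<in> f ` Ind" using finite_Ind S by (intro Max_in) auto
  then obtain R where R: "R \<in> Ind" "f R = Max (f ` Ind)" by auto
  have max: "f X \<le> f R" if "X \<in> Ind" for X using that finite_Ind R(2) by simp
  \<comment> \<open>By monotonicity a base containing an optimal independent set is optimal too. Its
    value also dominates \<open>M\<close>, which is 0 or the value of an independent
    singleton.\<close>
  obtain T where T: "base T" "R \<subseteq> T" using base_extend[OF R(1)] by blast
  have TN: "T \<subseteq> {..<n}" using T indep_subset_ground by (simp add: base_def)
  have "f R \<le> f T" using f_mono T(2) TN by blast
  then have MT: "M \<le> f T" and ST: "f S \<le> f T" and T0: "0 \<le> f T"
    using M max[OF S] max nonneg[OF TN] by (fastforce simp: scale_def)+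
  have "10 * f T \<le> 18 * f (?A \<union> ?B) + 2 * real (card T) * \<theta>"
  proof (rule local_optimum_bound[OF disj base T(1)])
    fix e v assume *: "e \<in> ?A \<union> ?B" "v \<notin> ?A \<union> ?B - {e}" "insert v (?A \<union> ?B - {e}) \<in> Ind"
    show "potential (insert v (?A - {e})) (?B - {e}) \<le> potential ?A ?B + \<theta> \<and>
        potential (?A - {e}) (insert v (?B - {e})) \<le> potential ?A ?B + \<theta>"
      using opt[of ?A ?B e v] opt[of ?B ?A e v] rej * potential_commute Un_commute[of ?A ?B] by metis
  qed
  \<comment> \<open>At most \<open>n\<close> exchanges each contribute \<open>2 * \<theta>\<close>.
    For \<open>n = 0\<close> the division by zero makes \<open>\<theta>\<close> equal to 0.\<close>
  moreover have "2 * real (card T) * \<theta> \<le> 2 / 3 * M"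
  proof (cases "n = 0")
    case False
    have "card T \<le> n" using card_mono[OF _ TN] by simp
    then have "real (card T) * M \<le> real n * M" using M0 by (intro mult_right_mono) auto
    then show ?thesis using False by (simp add: \<theta>_def field_simps)
  qed (use M0 in \<open>simp add: \<theta>_def\<close>)
  \<comment> \<open>Bounding \<open>M\<close> by \<open>f T\<close> leaves
    \<open>28 / 3 * f T \<le> 18 * f (?A \<union> ?B)\<close>, a ratio of 14/27.\<close>
  ultimately have "5008 / 10000 * f S \<le> f (?A \<union> ?B)" using MT ST T0 by linarith
  then show ?thesis by (simp add: out)
qed

lemma local_search_correct:
  "runs n f io local_search (initial_state n)
     (n * 16 + 2 + (1 + ((21 * n\<^sup>2 + 1) * (n * (n * 54 + 4) + 4) + 1)))
     (\<lambda>t. marked n t ''out'' \<in> Ind \<and> (\<forall>S\<in>Ind. 0.5008 * f S \<le> f (marked n t ''out'')))"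
  unfolding local_search_def
proof (rule runs_Seq)
  show "runs n f io (For ''i'' greedy_step) (initial_state n) (n * 16 + 2)
      (\<lambda>t. greedy_inv n t \<and> nmem t ''n'' [] = n)"
    using runs_For[where i = "''i''" and n = n and s = "initial_state n" and K = 14 and Inv = greedy_inv
      and c = greedy_step and vo = f and io = io] greedy_step_correct
    by (auto simp: greedy_inv_def initial_state_def write_nat_def stored_set_def indep_empty)
next
  fix t assume t: "greedy_inv n t \<and> nmem t ''n'' [] = n"
  then obtain M where M: "scale M" and inv: "search_inv M t" using greedy_inv_search_inv by blast
  let ?body = "Seq (NAssign ''go'' [] (NConst 0)) local_search_pass"
  show "runs n f io (Seq (NAssign ''go'' [] (NConst 1)) (While (NLess (NConst 0) (NVar ''go'')) ?body)) t
     (1 + ((21 * n\<^sup>2 + 1) * (n * (n * 54 + 4) + 4) + 1))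
     (\<lambda>t. marked n t ''out'' \<in> Ind \<and> (\<forall>S\<in>Ind. 0.5008 * f S \<le> f (marked n t ''out'')))"
  proof (rule runs_Seq)
    show "runs n f io (NAssign ''go'' [] (NConst 1)) t 1 (outer_inv M 0)"
      using inv by (intro runs_straight_line) (auto simp: outer_inv_def search_inv_write_scalar)
  next
    fix u assume u: "outer_inv M 0 u"
    have "runs n f io (While (NLess (NConst 0) (NVar ''go'')) ?body) u
      ((21 * n\<^sup>2 + 1 - 0) * (1 + (n * (n * 54 + 4) + 3)) + 1)
      (\<lambda>t. \<exists>k. outer_inv M k t \<and> \<not> bval (NLess (NConst 0) (NVar ''go'')) t)"
      by (rule runs_While[where Inv = "outer_inv M", OF _ u]) (use outer_inv_step[OF _ M] in auto)
    then show "runs n f io (While (NLess (NConst 0) (NVar ''go'')) ?body) u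
      ((21 * n\<^sup>2 + 1) * (n * (n * 54 + 4) + 4) + 1)
      (\<lambda>t. marked n t ''out'' \<in> Ind \<and> (\<forall>S\<in>Ind. 0.5008 * f S \<le> f (marked n t ''out'')))"
    proof (rule runs_mono)
      fix w assume "\<exists>k. outer_inv M k w \<and> \<not> bval (NLess (NConst 0) (NVar ''go'')) w"
      then obtain k where k: "outer_inv M k w" "nmem w ''go'' [] = 0" by auto
      then have "marked n w ''out'' \<in> Ind"
        unfolding outer_inv_def search_inv_def base_def by blast
      then show "marked n w ''out'' \<in> Ind \<and> (\<forall>S\<in>Ind. 0.5008 * f S \<le> f (marked n w ''out''))"
        using outer_inv_approximation[OF k(1) M k(2)] by blast
    qed simp
  qed
qed

end

section \<open>Transfer from indices to an arbitrary ground set\<close>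

theorem theorem1:
  "\<exists>(alg :: com) (p :: nat poly).
     \<forall>(N :: 'a set) (xs :: 'a list) (f :: 'a set \<Rightarrow> real) (Ind :: 'a set set).
       finite N \<and> distinct xs \<and> set xs = N \<and>
       (\<forall>S\<subseteq>N. 0 \<le> f S) \<and> mono_on (Pow N) f \<and> submodular_on N f \<and> matroid N Ind \<longrightarrow>
       (\<exists>I k. outputs alg xs f Ind I k \<and> k \<le> poly p (card N) \<and>
              I \<in> Ind \<and> f I \<ge> 0.5008 * Max (f ` Ind))"
proof -
  \<comment> \<open>With the indeterminate in place of \<open>n\<close>, the cost expression itself
    becomes the polynomial.\<close>
  define X :: "nat poly" where "X = [:0, 1:]"
  define p where "p = X * 16 + 2 + (1 + ((21 * X\<^sup>2 + 1) * (X * (X * 54 + 4) + 4) + 1))"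
  have p: "poly p n = n * 16 + 2 + (1 + ((21 * n\<^sup>2 + 1) * (n * (n * 54 + 4) + 4) + 1))" for n
    by (simp add: p_def X_def power2_eq_square)
  show ?thesis
  proof (intro exI[of _ local_search] exI[of _ p] allI impI)
    fix N :: "'a set" and xs :: "'a list" and f :: "'a set \<Rightarrow> real" and Ind :: "'a set set"
    assume "finite N \<and> distinct xs \<and> set xs = N \<and>
       (\<forall>S\<subseteq>N. 0 \<le> f S) \<and> mono_on (Pow N) f \<and> submodular_on N f \<and> matroid N Ind"
    then have xs: "distinct xs" "set xs = N" and f: "\<And>S. S \<subseteq> N \<Longrightarrow> 0 \<le> f S" "mono_on (Pow N) f"
      "submodular_on N f" and mat: "matroid N Ind" by auto
    interpret N: matroid N Ind by (rule mat)
    define n where "n = length xs"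
    have bij: "bij_betw ((!) xs) {..<n} N" using xs by (auto simp: n_def intro: bij_betw_nth)
    have img: "(!) xs ` {..<n} = N" using bij by (simp add: bij_betw_def)
    let ?g = "\<lambda>X. f ((!) xs ` X)" and ?Ind = "{X. X \<subseteq> {..<n} \<and> (!) xs ` X \<in> Ind}"
    interpret M: matroid "{..<n}" ?Ind by (rule matroid_vimage[OF mat bij])
    interpret indexed_problem n ?Ind ?g "\<lambda>X. (!) xs ` X \<in> Ind"
    proof
      show "0 \<le> ?g S" if "S \<subseteq> {..<n}" for S
        using f(1) image_mono[OF that, of "(!) xs"] unfolding img .
      show "mono_on (Pow {..<n}) ?g"
      proof (intro mono_onI)
        fix S T assume "S \<in> Pow {..<n}" "T \<in> Pow {..<n}" "S \<subseteq> T"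
        then have "(!) xs ` S \<in> Pow N" "(!) xs ` T \<in> Pow N" "(!) xs ` S \<subseteq> (!) xs ` T"
          using img by blast+
        then show "?g S \<le> ?g T" by (rule mono_onD[OF f(2)])
      qed
      show "submodular_on {..<n} ?g" by (rule submodular_on_vimage[OF f(3) bij])
      show "(!) xs ` S \<in> Ind \<longleftrightarrow> S \<in> ?Ind" if "S \<subseteq> {..<n}" for S using that by simp
    qed
    obtain k t where kt: "exec n ?g (\<lambda>X. (!) xs ` X \<in> Ind) local_search (initial_state n) k t \<and>
        k \<le> poly p n \<and> marked n t ''out'' \<in> ?Ind \<and>
        (\<forall>S\<in>?Ind. 0.5008 * ?g S \<le> ?g (marked n t ''out''))"
      using local_search_correct[unfolded runs_def, folded p] by (elim exE) (rule that)
    note run = kt[THEN conjunct1] and k = kt[THEN conjunct2, THEN conjunct1]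
      and I = kt[THEN conjunct2, THEN conjunct2, THEN conjunct1]
      and approx = kt[THEN conjunct2, THEN conjunct2, THEN conjunct2, THEN bspec]
    let ?I = "(!) xs ` marked n t ''out''"
    have "outputs local_search xs f Ind ?I k"
      using run unfolding outputs_def n_def by blast
    moreover have "card N = n" using xs by (auto simp: n_def distinct_card)
    moreover have "0.5008 * Max (f ` Ind) \<le> f ?I"
    proof -
      have "Max (f ` Ind) \<in> f ` Ind" using N.finite_Ind N.indep_empty by (intro Max_in) auto
      then obtain S where S: "S \<in> Ind" "f S = Max (f ` Ind)" by auto
      have "S \<subseteq> (!) xs ` {..<n}" using N.indep_subset_ground[OF S(1)] img by simp
      \<comment> \<open>The guarantee speaks of index sets, so an optimal set is pulled back to the
        indices of its elements.\<close>
      then obtain Y where "Y \<subseteq> {..<n}" "S = (!) xs ` Y" by (rule subset_imageE)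
      then show ?thesis using approx[of Y] S by simp
    qed
    ultimately show "\<exists>I k. outputs local_search xs f Ind I k \<and> k \<le> poly p (card N) \<and>
        I \<in> Ind \<and> f I \<ge> 0.5008 * Max (f ` Ind)"
      using k I by blast
  qed
qed

end
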